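(* Let $M=\Gamma\backslash\mathbb{H}^3$ be a convex cocompact hyperbolic 3-manifold with limit set $\Lambda$. Let $C$ be the boundary of a supporting hyperplane for $\mathrm{hull}(\Lambda)$. Then: 1. $\Gamma^C$ is a convex cocompact Fuchsian group; and 2. There is a finite set $\Lambda_0$ such that $$C\cap\Lambda=\Lambda(\Gamma^C)\cup\Gamma^C\Lambda_0.$$
   Context: $M=\Gamma\backslash\mathbb{H}^3$ is a complete oriented hyperbolic 3-manifold, $\Gamma$ a (torsion-free) discrete subgroup of $\mathrm{Isom}^+(\mathbb{H}^3)$ with limit set $\Lambda\subset S^2=\partial\mathbb{H}^3$, and $\mathrm{hull}(\Lambda)\subset\mathbb{H}^3$ is the convex hull of $\Lambda$. $M$ is convex cocompact if its convex core $\Gamma\backslash\mathrm{hull}(\Lambda)$ is compact and $\Gamma$ has no parabolics. A supporting hyperplane for $\mathrm{hull}(\Lambda)$ is a totally geodesic plane in $\mathbb{H}^3$ that meets $\mathrm{hull}(\Lambda)$ and such that $\mathrm{hull}(\Lambda)$ lies in one of the two closed half-spaces it bounds; its boundary is a circle $C\subset S^2$. $\Gamma^C=\{g\in\Gamma: g(C)=C\}$ (circles being oriented, $\Gamma^C$ is conjugate into $\mathrm{PSL}_2(\mathbb{R})$), and $\Lambda(\Gamma^C)$ denotes its limit set. Fuchsian groups are allowed to be elementary. *)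

theory Defs
  imports "HOL-Analysis.Analysis" "HOL-Algebra.Group"
begin

section \<open>Hyperbolic 3-space\<close>

text \<open>
  We use the projective (Klein) model, placed in the affine hyperplane where the fourth
  coordinate is 1 of Minkowski space with quadratic form of signature (3,1): points of
  hyperbolic space, respectively of the sphere at infinity, are the timelike, respectively
  lightlike, lines, each represented by its vector with fourth coordinate 1.  In this model
  geodesics are straight chords, so that hyperbolic convexity is convexity in the
  ambient affine space.
\<close>

definition mink :: "real ^ 4 \<Rightarrow> real ^ 4 \<Rightarrow> real" where
  "mink x y = x $ 1 * y $ 1 + x $ 2 * y $ 2 + x $ 3 * y $ 3 - x $ 4 * y $ 4"

definition H3 :: "(real ^ 4) set" where
  "H3 = {x. x $ 4 = 1 \<and> mink x x < 0}"

definition S2 :: "(real ^ 4) set" where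
  "S2 = {x. x $ 4 = 1 \<and> mink x x = 0}"

definition hdist :: "real ^ 4 \<Rightarrow> real ^ 4 \<Rightarrow> real" where
  "hdist x y = arcosh (- mink x y / sqrt (mink x x * mink y y))"

text \<open>
  Isometries are given by the linear maps that preserve the Minkowski form and the time
  orientation, acting projectively; those of determinant 1 are the orientation-preserving
  ones.  Lemmas \<open>act_isometry\<close> and \<open>isometry_is_act\<close> below show that these matrices are
  exactly the isometries of \<^const>\<open>H3\<close> for the hyperbolic distance \<^const>\<open>hdist\<close>.
\<close>

definition lorentz :: "(real ^ 4 ^ 4) set" where
  "lorentz = {A. (\<forall>x y. mink (A *v x) (A *v y) = mink x y) \<and> (\<forall>x\<in>H3. (A *v x) $ 4 > 0)}"

definition act :: "real ^ 4 ^ 4 \<Rightarrow> real ^ 4 \<Rightarrow> real ^ 4" where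
  "act A x = (1 / (A *v x) $ 4) *\<^sub>R (A *v x)"

definition Isom_plus :: "(real ^ 4 ^ 4) monoid" where
  "Isom_plus = \<lparr>carrier = {A \<in> lorentz. det A = 1}, mult = (**), one = mat 1\<rparr>"

lemma mink_pos: "x \<in> H3 \<Longrightarrow> - mink x x > 0"
  by (simp add: H3_def)

lemma reversed_Cauchy_Schwarz:
  assumes "x \<in> H3" "y \<in> H3"
  shows "sqrt (mink x x * mink y y) \<le> - mink x y" "mink x y < 0"
proof -
  define a1 a2 a3 b1 b2 b3 where ab: "a1 = x$1" "a2 = x$2" "a3 = x$3" "b1 = y$1" "b2 = y$2" "b3 = y$3"
  have x: "x$4 = 1" "a1*a1+a2*a2+a3*a3 < 1" and y: "y$4 = 1" "b1*b1+b2*b2+b3*b3 < 1"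
    using assms by (auto simp: H3_def mink_def ab)
  have "2*(a1*b1+a2*b2+a3*b3) \<le> (a1*a1+a2*a2+a3*a3) + (b1*b1+b2*b2+b3*b3)"
    using zero_le_square[of "a1-b1"] zero_le_square[of "a2-b2"] zero_le_square[of "a3-b3"]
    by (simp add: algebra_simps)
  then show neg: "mink x y < 0"
    using x y by (simp add: mink_def ab)
  have "(mink x y)^2 - mink x x * mink y y =
     ((a1-b1)^2+(a2-b2)^2+(a3-b3)^2) * (1 - (a1*a1+a2*a2+a3*a3))
      + (a1*(a1-b1)+a2*(a2-b2)+a3*(a3-b3))^2"
    using x(1) y(1) by (simp add: mink_def flip: ab) (simp add: power2_eq_square algebra_simps)
  also have "\<dots> \<ge> 0" using x by simp
  finally have "mink x x * mink y y \<le> (- mink x y)^2" by simp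
  then show "sqrt (mink x x * mink y y) \<le> - mink x y"
    using neg by (intro real_le_lsqrt) auto
qed

lemma mink_linear:
  "mink (c *\<^sub>R x) y = c * mink x y" "mink x (c *\<^sub>R y) = c * mink x y"
  "mink (x + z) y = mink x y + mink z y" "mink x (y + z) = mink x y + mink x z"
  "mink (x - z) y = mink x y - mink z y" "mink x (y - z) = mink x y - mink x z"
  "mink x y = mink y x"
  by (auto simp: mink_def algebra_simps)

lemma act_H3: "A \<in> lorentz \<Longrightarrow> x \<in> H3 \<Longrightarrow> act A x \<in> H3"
  by (auto simp: lorentz_def act_def H3_def mink_linear(1,2) divide_neg_pos less_le)
    (metis divide_neg_pos less_le not_real_square_gt_zero)

lemma act_isometry:
  assumes "A \<in> lorentz" "x \<in> H3" "y \<in> H3"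
  shows "hdist (act A x) (act A y) = hdist x y"
proof -
  define s t where st: "s = (A *v x) $ 4" "t = (A *v y) $ 4"
  have pos: "s > 0" "t > 0" using assms by (auto simp: lorentz_def st)
  have m: "mink (A *v u) (A *v v) = mink u v" for u v using assms by (auto simp: lorentz_def)
  have "mink (act A x) (act A x) * mink (act A y) (act A y) = (mink x x * mink y y) / (s*t)^2"
    by (simp add: act_def mink_linear(1,2) m power2_eq_square flip: st)
  then have "sqrt (mink (act A x) (act A x) * mink (act A y) (act A y)) = sqrt (mink x x * mink y y) / (s*t)"
    using pos by (simp add: real_sqrt_divide)
  moreover have "mink (act A x) (act A y) = mink x y / (s*t)"
    by (simp add: act_def mink_linear(1,2) m flip: st)
  ultimately show ?thesis using pos by (simp add: hdist_def)
qed

definition J :: "real ^ 4 ^ 4" where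
  "J = (\<chi> i j. if i = j then (if i = 4 then -1 else 1) else 0)"

lemma mink_J: "mink x y = x \<bullet> (J *v y)"
  unfolding mink_def inner_vec_def matrix_vector_mult_def J_def
  by (simp add: sum_4)

lemma JJ: "J ** J = mat 1"
  unfolding J_def matrix_matrix_mult_def mat_def vec_eq_iff forall_4
  by (simp add: sum_4)

lemma gram: "(transpose X ** J ** Y) $ i $ j = mink (column i X) (column j Y)"
  unfolding mink_def column_def matrix_matrix_mult_def J_def transpose_def
  by (simp add: sum_4)

lemma mink_transpose: "mink (A *v x) (A *v y) = x \<bullet> ((transpose A ** J ** A) *v y)"
proof -
  have "(transpose A ** J ** A) *v y = transpose A *v (J *v (A *v y))"
    by (simp add: matrix_vector_mul_assoc matrix_mul_assoc)
  then show ?thesis unfolding mink_J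
    by (metis dot_lmul_matrix inner_commute transpose_matrix_vector)
qed

lemma lorentz_iff_J:
  "(\<forall>x y. mink (A *v x) (A *v y) = mink x y) \<longleftrightarrow> transpose A ** J ** A = J"
proof
  assume "\<forall>x y. mink (A *v x) (A *v y) = mink x y"
  then have "x \<bullet> ((transpose A ** J ** A) *v y - J *v y) = 0" for x y
    by (simp only: mink_transpose inner_diff_right) (simp only: mink_J diff_self)
  then have "(transpose A ** J ** A) *v y = J *v y" for y
    by (metis inner_eq_zero_iff eq_iff_diff_eq_0)
  then show "transpose A ** J ** A = J" by (simp add: matrix_eq)
qed (metis mink_transpose mink_J)

definition hyperboloid :: "real ^ 4 \<Rightarrow> real ^ 4" where
  "hyperboloid x = (1 / sqrt (- mink x x)) *\<^sub>R x"

lemma mink_hyperboloid: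
  "x \<in> H3 \<Longrightarrow> y \<in> H3 \<Longrightarrow>
    mink (hyperboloid x) (hyperboloid y) = mink x y / sqrt (mink x x * mink y y)"
  by (simp add: hyperboloid_def mink_linear(1,2) flip: real_sqrt_mult)

lemma hdist_eq_hyperboloid:
  assumes "x \<in> H3" "y \<in> H3" "x' \<in> H3" "y' \<in> H3" "hdist x y = hdist x' y'"
  shows "mink (hyperboloid x) (hyperboloid y) = mink (hyperboloid x') (hyperboloid y')"
proof -
  have ge: "- mink u v / sqrt (mink u u * mink v v) \<ge> 1" if "u \<in> H3" "v \<in> H3" for u v
  proof -
    have "mink u u * mink v v > 0" using that by (simp add: H3_def mult_neg_neg)
    then have "sqrt (mink u u * mink v v) > 0" by simp
    then show ?thesis using reversed_Cauchy_Schwarz(1)[OF that] by (subst le_divide_eq_1_pos)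
  qed
  have "- mink x y / sqrt (mink x x * mink y y) = - mink x' y' / sqrt (mink x' x' * mink y' y')"
    using assms(5) ge[OF assms(1,2)] ge[OF assms(3,4)] unfolding hdist_def
    by (metis cosh_arcosh_real)
  then show ?thesis using assms by (simp add: mink_hyperboloid)
qed

definition base_pt :: "4 \<Rightarrow> real ^ 4" where
  "base_pt i = axis 4 1 + (if i = 4 then 0 else axis i (1/2))"

lemma base_pt_H3: "base_pt i \<in> H3"
  using exhaust_4[of i] by (auto simp: base_pt_def H3_def mink_def axis_def)

lemma base_pt_spanning:
  assumes "\<And>i. mink v (base_pt i) = 0" shows "v = 0"
  using assms[of 1] assms[of 2] assms[of 3] assms[of 4]
  by (simp add: base_pt_def mink_def axis_def vec_eq_iff forall_4)

lemma transpose_J: "(transpose X *v (J *v v)) $ i = mink v (column i X)"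
  unfolding mink_def column_def matrix_vector_mult_def J_def transpose_def
  by (simp add: sum_4 algebra_simps)

lemma isometry_is_act:
  assumes f: "f ` H3 \<subseteq> H3" and iso: "\<And>x y. x \<in> H3 \<Longrightarrow> y \<in> H3 \<Longrightarrow> hdist (f x) (f y) = hdist x y"
  shows "\<exists>!A. A \<in> lorentz \<and> (\<forall>x\<in>H3. f x = act A x)"
proof -
  define h where "h = hyperboloid"
  have f': "f x \<in> H3" if "x \<in> H3" for x using f that by auto
  have m: "mink (h (f x)) (h (f y)) = mink (h x) (h y)" if "x \<in> H3" "y \<in> H3" for x y
    unfolding h_def by (intro hdist_eq_hyperboloid f' that iso)
  define X Y :: "real^4^4" where
    "X = (\<chi> i j. h (base_pt j) $ i)" and "Y = (\<chi> i j. h (f (base_pt j)) $ i)"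
  have cX: "column j X = h (base_pt j)" and cY: "column j Y = h (f (base_pt j))" for j
    by (simp_all add: X_def Y_def column_def)
  have hpos: "1 / sqrt (- mink x x) > 0" if "x \<in> H3" for x using that by (simp add: H3_def)
  have span: "v = 0" if "\<And>i. mink v (h (base_pt i)) = 0" for v
  proof (rule base_pt_spanning)
    fix i show "mink v (base_pt i) = 0"
      using that[of i] hpos[OF base_pt_H3[of i]] by (simp add: h_def hyperboloid_def mink_linear(2))
  qed
  have "v = 0" if "(transpose X ** J) *v v = 0" for v
  proof (rule span)
    fix i show "mink v (h (base_pt i)) = 0"
      using that by (metis matrix_vector_mul_assoc transpose_J cX zero_index)
  qed
  then have "invertible (transpose X ** J)"
    by (metis invertible_left_inverse matrix_left_invertible_ker)
  then have "det X * det J \<noteq> 0" by (simp add: invertible_det_nz det_mul)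
  then have dX: "det X \<noteq> 0" and dJ: "det J \<noteq> 0" by auto
  have G: "transpose Y ** J ** Y = transpose X ** J ** X"
    by (simp add: vec_eq_iff gram cX cY m base_pt_H3)
  have "det Y * det J * det Y = det X * det J * det X"
    using arg_cong[OF G, of det] by (simp add: det_mul)
  with dX dJ have dY: "det Y \<noteq> 0" by auto
  obtain X' where X': "X ** X' = mat 1" "X' ** X = mat 1"
    using dX by (metis invertible_def invertible_det_nz)
  define A where "A = Y ** X'"
  have AX: "A ** X = Y" by (simp add: A_def X' flip: matrix_mul_assoc)
  have tX': "transpose X' ** transpose X = mat 1"
    by (metis X'(1) matrix_transpose_mul transpose_mat)
  have "transpose A ** J ** A = transpose X' ** (transpose Y ** J ** Y) ** X'"
    by (simp add: A_def matrix_transpose_mul matrix_mul_assoc)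
  also have "\<dots> = (transpose X' ** transpose X) ** J ** (X ** X')"
    by (simp add: G matrix_mul_assoc)
  finally have "transpose A ** J ** A = J" by (simp add: tX' X')
  then have mA: "mink (A *v x) (A *v y) = mink x y" for x y
    by (simp add: lorentz_iff_J[symmetric])
  have Ah: "A *v h x = h (f x)" if x: "x \<in> H3" for x
  proof -
    define v where "v = h (f x) - A *v h x"
    have "mink v (h (f (base_pt i))) = 0" for i
    proof -
      have "column i Y = A *v column i X"
        by (simp add: AX[symmetric] column_def matrix_matrix_mult_def matrix_vector_mult_def)
      then have e: "h (f (base_pt i)) = A *v h (base_pt i)" by (simp add: cX cY)
      have "mink v (h (f (base_pt i))) =
        mink (h (f x)) (h (f (base_pt i))) - mink (A *v h x) (A *v h (base_pt i))"
        by (simp add: v_def mink_linear(5) e)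
      then show ?thesis by (simp add: mA m x base_pt_H3)
    qed
    then have "(transpose Y *v (J *v v)) $ i = 0" for i by (simp only: transpose_J cY)
    then have "(transpose Y ** J) *v v = 0"
      by (simp only: vec_eq_iff matrix_vector_mul_assoc zero_index) simp
    moreover have "det (transpose Y ** J) \<noteq> 0" using dY dJ by (simp add: det_mul)
    ultimately have "v = 0"
      by (metis invertible_det_nz invertible_left_inverse matrix_left_invertible_ker)
    then show ?thesis by (simp add: v_def)
  qed
  have Ax: "\<exists>c>0. A *v x = c *\<^sub>R f x" if x: "x \<in> H3" for x
  proof -
    define c d where cd: "c = 1 / sqrt (- mink x x)" "d = 1 / sqrt (- mink (f x) (f x))"
    have pos: "c > 0" "d > 0" using hpos[OF x] hpos[OF f'[OF x]] by (simp_all only: cd)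
    have "c *\<^sub>R (A *v x) = d *\<^sub>R f x"
      using Ah[OF x] by (simp add: h_def hyperboloid_def matrix_vector_mult_scaleR flip: cd)
    then have "A *v x = (d / c) *\<^sub>R f x"
      using pos by (metis divideR_right divide_inverse_commute less_numeral_extra(3) scaleR_scaleR)
    then show ?thesis using pos by (intro exI[of _ "d / c"]) auto
  qed
  have A1: "(A *v x) $ 4 > 0 \<and> f x = act A x" if x: "x \<in> H3" for x
  proof -
    obtain c where c: "c > 0" "A *v x = c *\<^sub>R f x" using Ax[OF x] by auto
    have "f x $ 4 = 1" using f'[OF x] by (simp add: H3_def)
    then show ?thesis using c by (simp add: act_def)
  qed
  have "A \<in> lorentz \<and> (\<forall>x\<in>H3. f x = act A x)"
    using A1 mA by (simp add: lorentz_def)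
  moreover have "B = A" if B: "B \<in> lorentz \<and> (\<forall>x\<in>H3. f x = act B x)" for B
  proof -
    have mB: "mink (B *v x) (B *v y) = mink x y" for x y using B by (simp add: lorentz_def)
    have eq: "B *v x = A *v x" if x: "x \<in> H3" for x
    proof -
      define s t where st: "s = (B *v x) $ 4" "t = (A *v x) $ 4"
      have pos: "s > 0" "t > 0" using B A1 x by (auto simp: lorentz_def st)
      have e: "B *v x = s *\<^sub>R f x" "A *v x = t *\<^sub>R f x"
      proof -
        have "f x = act B x" "f x = act A x" using B A1 x by auto
        then have "s *\<^sub>R f x = s *\<^sub>R (1 / s) *\<^sub>R (B *v x)" "t *\<^sub>R f x = t *\<^sub>R (1 / t) *\<^sub>R (A *v x)"
          by (metis act_def st(1)) (metis \<open>f x = act A x\<close> act_def st(2))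
        then show "B *v x = s *\<^sub>R f x" "A *v x = t *\<^sub>R f x"
          using pos by (simp_all del: scaleR_cancel_left)
      qed
      have "s * s * mink (f x) (f x) = t * t * mink (f x) (f x)"
        using mA[of x x] mB[of x x] by (simp only: e mink_linear(1,2) mult.assoc)
      moreover have "mink (f x) (f x) \<noteq> 0" using f'[OF x] by (simp add: H3_def)
      ultimately have "s * s = t * t" by simp
      then have "s = t" using pos by (simp add: square_eq_iff)
      then show ?thesis by (simp add: e)
    qed
    have "B *v column j X = A *v column j X" for j
      using eq[OF base_pt_H3[of j]]
      by (simp add: cX h_def hyperboloid_def matrix_vector_mult_scaleR)
    then have "B ** X = A ** X"
      by (simp add: vec_eq_iff column_def matrix_matrix_mult_def matrix_vector_mult_def)
    then show "B = A"
      by (metis X'(1) matrix_mul_assoc matrix_mul_rid)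
  qed
  ultimately show ?thesis by blast
qed

lemma group_Isom_plus: "group Isom_plus"
proof (rule groupI)
  fix A B assume "A \<in> carrier Isom_plus" "B \<in> carrier Isom_plus"
  then have A: "A \<in> lorentz" "det A = 1" and B: "B \<in> lorentz" "det B = 1"
    by (auto simp: Isom_plus_def)
  have "((A ** B) *v x) $ 4 > 0" if x: "x \<in> H3" for x
  proof -
    have s: "(B *v x) $ 4 > 0" and t: "(A *v act B x) $ 4 > 0"
      using A B x act_H3[OF B(1) x] by (auto simp: lorentz_def)
    have "(A ** B) *v x = (B *v x) $ 4 *\<^sub>R (A *v act B x)"
      using s by (simp add: act_def matrix_vector_mult_scaleR matrix_vector_mul_assoc)
    then show ?thesis using s t by simp
  qed
  then show "A \<otimes>\<^bsub>Isom_plus\<^esub> B \<in> carrier Isom_plus"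
    using A B by (simp add: Isom_plus_def lorentz_def det_mul flip: matrix_vector_mul_assoc)
next
  fix A assume "A \<in> carrier Isom_plus"
  then have A: "A \<in> lorentz" "det A = 1" by (auto simp: Isom_plus_def)
  obtain B where B: "A ** B = mat 1" "B ** A = mat 1"
    using A(2) by (metis invertible_def invertible_det_nz zero_neq_one)
  have AB: "A *v (B *v x) = x" for x by (simp add: matrix_vector_mul_assoc B)
  have mB: "mink (B *v x) (B *v y) = mink x y" for x y
    using A(1) AB by (metis (mono_tags, lifting) lorentz_def mem_Collect_eq)
  have "(B *v x) $ 4 > 0" if x: "x \<in> H3" for x
  proof -
    define t where "t = (B *v x) $ 4"
    have neg: "mink (B *v x) (B *v x) < 0" using x by (simp add: mB H3_def)
    have "t \<noteq> 0"
    proof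
      assume "t = 0"
      then have "mink (B *v x) (B *v x) \<ge> 0" by (simp add: mink_def t_def)
      with neg show False by simp
    qed
    moreover have "(1 / t) *\<^sub>R (B *v x) \<in> H3"
      using neg \<open>t \<noteq> 0\<close> not_real_square_gt_zero[of t]
      by (auto simp: H3_def mink_linear(1,2) t_def[symmetric] divide_neg_pos less_le)
        (metis divide_neg_pos less_le not_real_square_gt_zero)
    then have "(A *v ((1 / t) *\<^sub>R (B *v x))) $ 4 > 0" using A(1) by (auto simp: lorentz_def)
    then have "1 / t > 0" using x by (simp add: matrix_vector_mult_scaleR AB H3_def)
    then show ?thesis by (simp add: t_def)
  qed
  moreover have "det B = 1" using A(2) B(1) by (metis det_I det_mul mult_1)
  ultimately have "B \<in> carrier Isom_plus" by (simp add: Isom_plus_def lorentz_def mB)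
  then show "\<exists>B\<in>carrier Isom_plus. B \<otimes>\<^bsub>Isom_plus\<^esub> A = \<one>\<^bsub>Isom_plus\<^esub>"
    using B by (auto simp: Isom_plus_def)
qed (auto simp: Isom_plus_def lorentz_def H3_def matrix_mul_assoc)

section \<open>Kleinian groups and convex cores\<close>

text \<open>\<open>discrete\<close> refers to the topology of the matrix group, i.e. of \<open>Isom_plus\<close> as a Lie group.\<close>

definition kleinian :: "(real ^ 4 ^ 4) set \<Rightarrow> bool" where
  "kleinian \<Gamma> \<longleftrightarrow> subgroup \<Gamma> Isom_plus \<and> discrete \<Gamma>"

definition torsion_free :: "(real ^ 4 ^ 4) set \<Rightarrow> bool" where
  "torsion_free \<Gamma> \<longleftrightarrow>
    (\<forall>g\<in>\<Gamma>. \<forall>k::nat. k > 0 \<longrightarrow> g [^]\<^bsub>Isom_plus\<^esub> k = \<one>\<^bsub>Isom_plus\<^esub> \<longrightarrow> g = \<one>\<^bsub>Isom_plus\<^esub>)"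

text \<open>No fixed point inside, and exactly one at infinity.\<close>

definition parabolic :: "real ^ 4 ^ 4 \<Rightarrow> bool" where
  "parabolic g \<longleftrightarrow> (\<forall>x\<in>H3. act g x \<noteq> x) \<and> (\<exists>!u. u \<in> S2 \<and> act g u = u)"

definition orb :: "(real ^ 4 ^ 4) set \<Rightarrow> real ^ 4 \<Rightarrow> (real ^ 4) set" where
  "orb \<Gamma> x = (\<lambda>g. act g x) ` \<Gamma>"

definition limit_set :: "(real ^ 4 ^ 4) set \<Rightarrow> (real ^ 4) set" where
  "limit_set \<Gamma> = {\<xi> \<in> S2. \<exists>x\<in>H3. \<xi> islimpt orb \<Gamma> x}"

text \<open>
  The straight convex hull in the closed ball is the hyperbolic convex hull (Klein model);
  only its part inside hyperbolic space is kept.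
\<close>

definition hull3 :: "(real ^ 4) set \<Rightarrow> (real ^ 4) set" where
  "hull3 \<Lambda> = H3 \<inter> convex hull \<Lambda>"

text \<open>
  \<open>orbit_space \<Gamma> X\<close> is the quotient of an invariant set \<open>X\<close> by \<open>\<Gamma>\<close>, its points being
  the orbits, with the quotient topology.
\<close>

definition orbit_space :: "(real ^ 4 ^ 4) set \<Rightarrow> (real ^ 4) set \<Rightarrow> (real ^ 4) set topology" where
  "orbit_space \<Gamma> X =
    topology (\<lambda>U. U \<subseteq> orb \<Gamma> ` X \<and> openin (top_of_set X) {x \<in> X. orb \<Gamma> x \<in> U})"

lemma quotient_map_orbit_space: "quotient_map (top_of_set X) (orbit_space \<Gamma> X) (orb \<Gamma>)"
proof -
  let ?L = "\<lambda>U. U \<subseteq> orb \<Gamma> ` X \<and> openin (top_of_set X) {x \<in> X. orb \<Gamma> x \<in> U}"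
  have "istopology ?L"
    unfolding istopology_def
  proof (rule conjI; intro allI impI)
    fix S T assume "?L S" "?L T"
    moreover have "{x \<in> X. orb \<Gamma> x \<in> S \<inter> T} = {x \<in> X. orb \<Gamma> x \<in> S} \<inter> {x \<in> X. orb \<Gamma> x \<in> T}" by auto
    ultimately show "?L (S \<inter> T)" by auto
  next
    fix \<K> assume K: "\<forall>K\<in>\<K>. ?L K"
    have "{x \<in> X. orb \<Gamma> x \<in> \<Union>\<K>} = (\<Union>K\<in>\<K>. {x \<in> X. orb \<Gamma> x \<in> K})" by auto
    with K show "?L (\<Union>\<K>)" by (auto simp: Sup_le_iff)
  qed
  then have o: "openin (orbit_space \<Gamma> X) = ?L"
    by (simp add: orbit_space_def)
  have "{x \<in> X. orb \<Gamma> x \<in> orb \<Gamma> ` X} = X" by auto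
  then have "?L (orb \<Gamma> ` X)" by simp
  then have "topspace (orbit_space \<Gamma> X) = orb \<Gamma> ` X"
    unfolding topspace_def o by blast
  then show ?thesis by (auto simp: quotient_map_def o)
qed

text \<open>
  The convex core \<open>\<Gamma> \ hull(\<Lambda>)\<close> as a subset of the quotient of \<open>X\<close>, where \<open>X\<close> is \<^const>\<open>H3\<close> for a
  Kleinian group and the invariant hyperbolic plane for a Fuchsian group.
\<close>

definition convex_cocompact_on :: "(real ^ 4) set \<Rightarrow> (real ^ 4 ^ 4) set \<Rightarrow> bool" where
  "convex_cocompact_on X \<Gamma> \<longleftrightarrow>
    compactin (orbit_space \<Gamma> X) (orb \<Gamma> ` (X \<inter> hull3 (limit_set \<Gamma>))) \<and> (\<forall>g\<in>\<Gamma>. \<not> parabolic g)"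

section \<open>Planes and oriented circles\<close>

text \<open>
  A unit spacelike vector \<open>n\<close> determines a totally geodesic plane, its boundary circle, and
  one of the two complementary discs of that circle; the disc orients the circle (and \<open>-n\<close>
  gives the opposite orientation).  Every plane and every oriented circle arises in this way.
\<close>

definition plane :: "real ^ 4 \<Rightarrow> (real ^ 4) set" where
  "plane n = {x \<in> H3. mink n x = 0}"

definition circle :: "real ^ 4 \<Rightarrow> (real ^ 4) set" where
  "circle n = {u \<in> S2. mink n u = 0}"

definition disc :: "real ^ 4 \<Rightarrow> (real ^ 4) set" where
  "disc n = {u \<in> S2. mink n u > 0}"

definition supporting :: "real ^ 4 \<Rightarrow> (real ^ 4) set \<Rightarrow> bool" where
  "supporting n K \<longleftrightarrow> mink n n = 1 \<and> plane n \<inter> K \<noteq> {} \<and>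
     (K \<subseteq> {x \<in> H3. mink n x \<ge> 0} \<or> K \<subseteq> {x \<in> H3. mink n x \<le> 0})"

definition circle_stab :: "(real ^ 4 ^ 4) set \<Rightarrow> real ^ 4 \<Rightarrow> (real ^ 4 ^ 4) set" where
  "circle_stab \<Gamma> n = {g \<in> \<Gamma>. act g ` circle n = circle n \<and> act g ` disc n = disc n}"

text \<open>
  The stabilizer of an oriented circle in \<^const>\<open>Isom_plus\<close> is a conjugate of
  \<open>PSL\<^sub>2(\<real>)\<close>, acting on the plane bounded by the circle; a Fuchsian group is a discrete
  subgroup of it.
\<close>

definition fuchsian :: "real ^ 4 \<Rightarrow> (real ^ 4 ^ 4) set \<Rightarrow> bool" where
  "fuchsian n G \<longleftrightarrow> kleinian G \<and> mink n n = 1 \<and> G \<subseteq> circle_stab (carrier Isom_plus) n"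

definition convex_cocompact_fuchsian :: "real ^ 4 \<Rightarrow> (real ^ 4 ^ 4) set \<Rightarrow> bool" where
  "convex_cocompact_fuchsian n G \<longleftrightarrow> fuchsian n G \<and> convex_cocompact_on (plane n) G"

end

theory Submission
  imports Defs
begin

text \<open>
  Let \<open>L = circle n \<inter> \<Lambda>\<close> and let \<open>G\<close> be the stabilizer of the oriented circle.  Everything
  follows from one fact: if \<open>L\<close> has at least three points, then \<open>G\<close> acts cocompactly on the
  triples of distinct points of \<open>L\<close>, that is, every such triple has a translate under \<open>G\<close> whose
  points are a definite distance apart (\<open>stabilizer_triple_cocompact\<close>).

  To see this, attach to a triple the centre of its ideal triangle.  It lies in the hull, so
  compactness of the convex core gives \<open>g \<in> \<Gamma>\<close> that carries it to a bounded part of hyperbolic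
  space, and then the translated triple is separated.  Now \<open>g n\<close> is the normal of a supporting
  plane of the hull whose face contains a thick triangle, and there are only finitely many such
  planes (\<open>finite_thick_supports\<close>): two of them that are close to each other, with normals
  pointing to the same side, each have a large triangle on the correct side of the other, which
  forces them to coincide.  So, up to finitely many fixed elements of \<open>\<Gamma>\<close>, the element \<open>g\<close> fixes
  \<open>n\<close>, and hence can be chosen in \<open>G\<close>.

  From here the argument is dynamical and concerns \<open>G\<close> and \<open>L\<close> only.  A point \<open>\<xi>\<close> of the sphere
  is called horospherical below if orbits of \<open>G\<close> enter every horoball at \<open>\<xi>\<close>; in the linear model this says
  that the fourth coordinate of \<open>g \<xi>\<close> can be made arbitrarily small.  Renormalizing triples
  \<open>(\<xi>, a, b)\<close> with \<open>a\<close> tending to \<open>\<xi>\<close> shows that points of \<open>L\<close> that are not isolated in \<open>L\<close> are horospherical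
  (\<open>islimpt_horospherical\<close>), and these are limit points of \<open>G\<close> (\<open>horospherical_limit\<close>).
  Conversely, a limit point of \<open>G\<close> is not isolated in \<open>L\<close> as soon as \<open>L\<close> has three points
  (\<open>limit_set_islimpt\<close>), so every limit point is horospherical; when \<open>L\<close> is a pair of points,
  every element of \<open>G\<close> that contracts one of them dilates the other, which gives the same conclusion
  (\<open>two_point_horospherical\<close>).  There are no other cases: a supporting plane meets the hull in the hull of
  \<open>L\<close> (\<open>supporting_plane_hull\<close>), so \<open>L\<close> has at least two points.

  If all limit points are horospherical, then the part of the hull of \<open>\<Lambda>(G)\<close> in a
  Dirichlet domain cannot reach the sphere at infinity, so it is compact (\<open>hull_cocompact\<close>); this
  is the convex cocompactness of \<open>G\<close>.  Finally, an isolated point \<open>\<xi>\<close> of \<open>L\<close> is put in a triple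
  \<open>(\<xi>, a, b)\<close> where \<open>a\<close> is almost nearest to \<open>\<xi>\<close> as seen from \<open>b\<close>; after separating this triple by
  an element of \<open>G\<close>, the point is isolated by a uniform distance, and by compactness only finitely many points of \<open>L\<close>
  are (\<open>isolated_points_finite\<close>).  These form the set \<open>\<Lambda>\<^sub>0\<close>;
  when \<open>L\<close> is a pair of points, \<open>\<Lambda>\<^sub>0 = L\<close> will do.
\<close>

section \<open>Hyperbolic space with its sphere at infinity\<close>

definition closed_ball :: "(real ^ 4) set" where
  "closed_ball = {x. x $ 4 = 1 \<and> mink x x \<le> 0}"

text \<open>
  The centre of the ball.  As \<open>mink origin x = - x $ 4\<close>, pairing with it turns statements about
  fourth coordinates into statements about the invariant form.
\<close>

definition origin :: "real ^ 4" where
  "origin = axis 4 1"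

text \<open>
  The factor by which a Lorentz matrix rescales the normalized representative of a point, so that
  \<open>A *v x = wt A x *\<^sub>R act A x\<close>; it is a cocycle.  On the sphere, \<open>1 / wt A u\<close> is the conformal
  derivative of \<open>act A\<close> at \<open>u\<close>; for \<open>x\<close> fixed in \<^const>\<open>H3\<close> it grows like
  the exponential of the distance from \<^const>\<open>origin\<close> to \<open>act A x\<close>.
\<close>

definition wt :: "real ^ 4 ^ 4 \<Rightarrow> real ^ 4 \<Rightarrow> real" where
  "wt A x = (A *v x) $ 4"

lemma closed_ball_eq: "closed_ball = H3 \<union> S2"
  by (auto simp: closed_ball_def H3_def S2_def)

lemma H3_closed_ball: "x \<in> H3 \<Longrightarrow> x \<in> closed_ball"
  and S2_closed_ball: "x \<in> S2 \<Longrightarrow> x \<in> closed_ball"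
  by (auto simp: closed_ball_eq)

lemma origin_H3: "origin \<in> H3"
  by (simp add: origin_def H3_def mink_def axis_def)

lemma mink_origin: "mink origin x = - (x $ 4)" "mink x origin = - (x $ 4)"
  by (simp_all add: origin_def mink_def axis_def)

lemma mink_origin_self: "mink origin origin = -1"
  by (simp add: origin_def mink_def axis_def)

lemma continuous_mink [continuous_intros]:
  "continuous_on S f \<Longrightarrow> continuous_on S g \<Longrightarrow> continuous_on S (\<lambda>x. mink (f x) (g x))"
  unfolding mink_def by (intro continuous_intros)

lemma tendsto_mink [tendsto_intros]:
  "(f \<longlongrightarrow> a) F \<Longrightarrow> (g \<longlongrightarrow> b) F \<Longrightarrow> ((\<lambda>x. mink (f x) (g x)) \<longlongrightarrow> mink a b) F"
  unfolding mink_def by (intro tendsto_intros)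

lemma norm_power2_4: "(norm x)\<^sup>2 = x $ 1 * x $ 1 + x $ 2 * x $ 2 + x $ 3 * x $ 3 + x $ 4 * x $ (4::4)"
  for x :: "real ^ 4"
  by (simp add: power2_norm_eq_inner inner_vec_def sum_4)

lemma dist_power2_eq:
  assumes "p $ 4 = 1" "q $ 4 = 1"
  shows "(dist p q)\<^sup>2 = mink p p + mink q q - 2 * mink p q"
  using assms by (simp add: dist_norm norm_power2_4 mink_def algebra_simps)

text \<open>
  The difference of two normalized points has fourth coordinate 0, so its Euclidean norm is its
  Minkowski norm.  Hence estimates on the invariant form become estimates on distances in the
  closed ball.
\<close>

lemma dist_power2_le: "p \<in> closed_ball \<Longrightarrow> q \<in> closed_ball \<Longrightarrow> (dist p q)\<^sup>2 \<le> 2 * - mink p q"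
  by (auto simp: closed_ball_def dist_power2_eq)

lemma dist_power2_S2: "p \<in> S2 \<Longrightarrow> q \<in> S2 \<Longrightarrow> (dist p q)\<^sup>2 = 2 * - mink p q"
  by (auto simp: S2_def dist_power2_eq)

lemma mink_closed_ball_nonpos: "p \<in> closed_ball \<Longrightarrow> q \<in> closed_ball \<Longrightarrow> mink p q \<le> 0"
  using dist_power2_le[of p q] by (smt (verit) zero_le_power2)

lemma mink_closed_ball_zero: "p \<in> closed_ball \<Longrightarrow> q \<in> closed_ball \<Longrightarrow> mink p q = 0 \<Longrightarrow> p = q"
  using dist_power2_le[of p q] by simp

lemma mink_closed_ball_neg: "p \<in> closed_ball \<Longrightarrow> q \<in> closed_ball \<Longrightarrow> p \<noteq> q \<Longrightarrow> mink p q < 0"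
  using mink_closed_ball_nonpos mink_closed_ball_zero by (meson less_eq_real_def)

lemma mink_H3_neg: "p \<in> H3 \<Longrightarrow> q \<in> closed_ball \<Longrightarrow> mink p q < 0"
  using mink_closed_ball_neg[of p q] by (cases "p = q") (auto simp: H3_def closed_ball_def)

lemma mink_closed_ball_ge: 
  assumes "p \<in> closed_ball" "q \<in> closed_ball" shows "- mink p q \<le> 2"
proof -
  have "0 \<le> (p$1 + q$1)\<^sup>2 + (p$2 + q$2)\<^sup>2 + (p$3 + q$3)\<^sup>2" by simp
  also have "\<dots> \<le> 2 + 2 * (p$1*q$1 + p$2*q$2 + p$3*q$3)"
    using assms by (auto simp: closed_ball_def mink_def power2_eq_square algebra_simps)
  finally show ?thesis using assms by (simp add: closed_ball_def mink_def)
qed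

lemma convex_closed_ball: "convex closed_ball"
proof (rule convexI)
  fix x y :: "real^4" and u v :: real
  assume x: "x \<in> closed_ball" and y: "y \<in> closed_ball" and uv: "0 \<le> u" "0 \<le> v" "u + v = 1"
  have "mink (u *\<^sub>R x + v *\<^sub>R y) (u *\<^sub>R x + v *\<^sub>R y)
      = u * u * mink x x + 2 * (u * v) * mink x y + v * v * mink y y"
    by (simp add: mink_def algebra_simps)
  also have "\<dots> \<le> 0"
    using mink_closed_ball_nonpos[OF x y] mink_closed_ball_nonpos[OF x x]
      mink_closed_ball_nonpos[OF y y] uv
    by (smt (verit) mult_nonneg_nonpos mult_nonneg_nonneg)
  finally show "u *\<^sub>R x + v *\<^sub>R y \<in> closed_ball"
    using x y uv by (simp add: closed_ball_def)
qed

lemma open_segment_H3: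
  assumes x: "x \<in> H3" and y: "y \<in> closed_ball" and uv: "0 < u" "0 \<le> v" "u + v = 1"
  shows "u *\<^sub>R x + v *\<^sub>R y \<in> H3"
proof -
  have "mink (u *\<^sub>R x + v *\<^sub>R y) (u *\<^sub>R x + v *\<^sub>R y)
      = u * u * mink x x + 2 * (u * v) * mink x y + v * v * mink y y"
    by (simp add: mink_def algebra_simps)
  moreover have "u * u * mink x x < 0" using x uv by (simp add: H3_def mult_pos_neg)
  moreover have "(u * v) * mink x y \<le> 0" "v * v * mink y y \<le> 0"
    using mink_H3_neg[OF x y] mink_closed_ball_nonpos[OF y y] uv
    by (auto intro!: mult_nonneg_nonpos)
  ultimately show ?thesis using x y uv by (simp add: H3_def closed_ball_def)
qed

lemma midpoint_H3:
  assumes "u \<in> S2" "v \<in> S2" "u \<noteq> v" shows "(1/2) *\<^sub>R (u + v) \<in> H3"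
  using mink_closed_ball_neg[of u v] assms
  by (auto simp: S2_closed_ball H3_def S2_def mink_linear(1-4) mink_linear(7)[of v u])

lemma compact_S2: "compact S2"
proof -
  have "closed ({x::real^4. x $ 4 = 1} \<inter> {x. mink x x = 0})"
    by (intro closed_Int closed_Collect_eq continuous_intros)
  moreover have "{x. x $ 4 = 1} \<inter> {x. mink x x = 0} = S2" by (auto simp: S2_def)
  ultimately have "closed S2" by simp
  moreover have "bounded S2"
  proof (rule boundedI)
    fix x assume "x \<in> S2"
    then have "(norm x)\<^sup>2 = 2" by (simp add: S2_def mink_def norm_power2_4)
    then have "norm x = sqrt 2" by (smt (verit) norm_ge_zero real_sqrt_unique)
    then show "norm x \<le> sqrt 2" by simp
  qed
  ultimately show ?thesis by (simp add: compact_eq_bounded_closed)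
qed

text \<open>
  Points of the sphere are exposed points of the closed ball: the tangent plane at \<open>x\<close>, which is the zero
  set of \<open>mink x\<close>, meets the ball only in \<open>x\<close>.
\<close>

lemma S2_convex_hull:
  assumes L: "L \<subseteq> S2" and x: "x \<in> S2" "x \<in> convex hull L" shows "x \<in> L"
proof (rule ccontr)
  assume "x \<notin> L"
  then have "L \<subseteq> {v. mink x v < 0}"
    using L x by (auto intro!: mink_closed_ball_neg simp: S2_closed_ball subset_iff)
  moreover have "convex {v. mink x v < 0}"
    by (rule convexI) (auto simp: mink_linear(1-4), smt (verit) mult_nonneg_nonpos mult_pos_neg)
  ultimately have "convex hull L \<subseteq> {v. mink x v < 0}" by (rule hull_minimal)
  then show False using x by (auto simp: S2_def)
qed

lemma hull_S2_closed_ball: "L \<subseteq> S2 \<Longrightarrow> convex hull L \<subseteq> closed_ball"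
  by (rule hull_minimal) (auto simp: S2_closed_ball convex_closed_ball)

section \<open>The projective action of Lorentz matrices\<close>

lemma mink_lorentz: "A \<in> lorentz \<Longrightarrow> mink (A *v x) (A *v y) = mink x y"
  by (simp add: lorentz_def)

lemma wt_linear: "wt A (x + y) = wt A x + wt A y" "wt A (c *\<^sub>R x) = c * wt A x"
  by (simp_all add: wt_def matrix_vector_right_distrib matrix_vector_mult_scaleR)

text \<open>
  At infinity, positivity follows from the interior by continuity, except that the limit could
  vanish; but then a null vector would have fourth coordinate 0, so \<open>A\<close> would kill \<open>x\<close>.
\<close>

lemma wt_pos:
  assumes A: "A \<in> lorentz" and x: "x \<in> closed_ball" shows "wt A x > 0"
proof (cases "x \<in> H3")
  case True then show ?thesis using A by (auto simp: lorentz_def wt_def)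
next
  case False
  then have "mink x x = 0" using x by (auto simp: closed_ball_eq S2_def)
  have *: "t * wt A origin + (1 - t) * wt A x > 0" if t: "t > 0" "t \<le> 1" for t
  proof -
    have "t *\<^sub>R origin + (1 - t) *\<^sub>R x \<in> H3" using open_segment_H3[OF origin_H3 x, of t "1-t"] t by simp
    then have "wt A (t *\<^sub>R origin + (1 - t) *\<^sub>R x) > 0" using A by (auto simp: lorentz_def wt_def)
    then show ?thesis by (simp add: wt_linear)
  qed
  have "((\<lambda>t. t * wt A origin + (1 - t) * wt A x) \<longlongrightarrow> 0 * wt A origin + (1 - 0) * wt A x) (at_right 0)"
    by (intro tendsto_intros)
  moreover have "\<forall>\<^sub>F t in at_right (0::real). t * wt A origin + (1 - t) * wt A x \<ge> 0"
    using * by (intro eventually_at_rightI[of 0 1]) (auto intro: less_imp_le)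
  ultimately have "0 \<le> 0 * wt A origin + (1 - 0) * wt A x"
    by (intro tendsto_lowerbound) auto
  moreover have "wt A x \<noteq> 0"
  proof
    assume "wt A x = 0"
    moreover have "mink (A *v x) (A *v x) = 0" using A \<open>mink x x = 0\<close> by (simp add: mink_lorentz)
    ultimately have "(A *v x) $ 1 * (A *v x) $ 1 + (A *v x) $ 2 * (A *v x) $ 2 + (A *v x) $ 3 * (A *v x) $ 3 = 0"
      by (simp add: mink_def wt_def)
    then have "norm (A *v x) ^ 2 = 0" using \<open>wt A x = 0\<close> by (simp only: norm_power2_4 wt_def)
    then have "A *v x = 0" by simp
    then have "mink x origin = 0" using mink_lorentz[OF A, of x origin] by (simp add: mink_def)
    then show False using x by (simp add: mink_origin closed_ball_def)
  qed
  ultimately show ?thesis by simp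
qed

lemma mult_act: "A \<in> lorentz \<Longrightarrow> x \<in> closed_ball \<Longrightarrow> A *v x = wt A x *\<^sub>R act A x"
  using wt_pos[of A x] by (simp add: act_def wt_def)

lemma mink_act:
  "A \<in> lorentz \<Longrightarrow> x \<in> closed_ball \<Longrightarrow> y \<in> closed_ball \<Longrightarrow>
    mink x y = wt A x * wt A y * mink (act A x) (act A y)"
  using mink_lorentz[of A x y] by (simp add: mult_act mink_linear(1,2) mult_ac)

lemma act_nth4: "A \<in> lorentz \<Longrightarrow> x \<in> closed_ball \<Longrightarrow> act A x $ 4 = 1"
  using wt_pos[of A x] by (simp add: act_def wt_def)

lemma act_S2: "A \<in> lorentz \<Longrightarrow> x \<in> S2 \<Longrightarrow> act A x \<in> S2"
  using mink_act[of A x x] wt_pos[of A x] act_nth4[of A x]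
  by (auto simp: S2_def closed_ball_def)

lemma act_closed_ball: "A \<in> lorentz \<Longrightarrow> x \<in> closed_ball \<Longrightarrow> act A x \<in> closed_ball"
  using act_S2 act_H3 by (auto simp: closed_ball_eq)

lemma act_mult:
  assumes "A \<in> lorentz" "B \<in> lorentz" "x \<in> closed_ball"
  shows "act (A ** B) x = act A (act B x)" "wt (A ** B) x = wt A (act B x) * wt B x"
proof -
  have "(A ** B) *v x = wt B x *\<^sub>R (A *v act B x)"
    using assms by (simp add: mult_act matrix_vector_mult_scaleR flip: matrix_vector_mul_assoc)
  then show "act (A ** B) x = act A (act B x)" "wt (A ** B) x = wt A (act B x) * wt B x"
    using wt_pos[OF assms(2,3)] by (simp_all add: act_def wt_def)
qed

lemma act_one: "x \<in> closed_ball \<Longrightarrow> act (mat 1) x = x"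
  by (simp add: act_def closed_ball_def)

lemma wt_one: "x \<in> closed_ball \<Longrightarrow> wt (mat 1) x = 1"
  by (simp add: wt_def closed_ball_def)

lemma act_inverse:
  assumes "A \<in> lorentz" "B \<in> lorentz" "B ** A = mat 1" "x \<in> closed_ball"
  shows "act B (act A x) = x"
  using act_mult(1)[of B A x] assms by (simp add: act_one)

lemma continuous_act:
  assumes "A \<in> lorentz" shows "continuous_on closed_ball (act A)"
  unfolding act_def using wt_pos[OF assms] unfolding wt_def
  by (intro continuous_intros continuous_on_component matrix_vector_mult_linear_continuous_on) fastforce+

text \<open>
  An orbit stays in the hyperboloid of vectors of Minkowski square \<open>mink x x\<close>, where the fourth
  coordinate is bounded below.
\<close>

lemma wt_H3_ge:
  assumes A: "A \<in> lorentz" and x: "x \<in> H3" shows "sqrt (- mink x x) \<le> wt A x"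
proof (rule real_le_lsqrt)
  let ?p = "act A x"
  have p: "?p \<in> H3" using act_H3[OF A x] .
  have w: "wt A x > 0" using wt_pos[OF A] x H3_closed_ball by blast
  have "- mink ?p ?p \<le> 1"
    using p zero_le_square[of "?p $ 1"] zero_le_square[of "?p $ 2"] zero_le_square[of "?p $ 3"]
    unfolding H3_def mink_def by (simp add: algebra_simps)
  then have "(wt A x)\<^sup>2 * - mink ?p ?p \<le> (wt A x)\<^sup>2 * 1" by (intro mult_left_mono) auto
  then show "- mink x x \<le> (wt A x)\<^sup>2"
    using mink_act[OF A, of x x] x by (simp add: H3_closed_ball power2_eq_square)
  show "0 \<le> wt A x" using w by simp
qed

lemma dist_act_power2_le:
  assumes A: "A \<in> lorentz" and x: "x \<in> closed_ball" and y: "y \<in> closed_ball"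
  shows "(dist (act A x) (act A y))\<^sup>2 \<le> 2 * (- mink x y) / (wt A x * wt A y)"
proof -
  have "(dist (act A x) (act A y))\<^sup>2 \<le> 2 * - mink (act A x) (act A y)"
    by (intro dist_power2_le act_closed_ball A x y)
  also have "\<dots> = 2 * (- mink x y) / (wt A x * wt A y)"
    using wt_pos[OF A x] wt_pos[OF A y] by (subst mink_act[OF A x y]) simp
  finally show ?thesis .
qed

text \<open>
  A projective map sends segments to segments, with weights rescaled by \<^const>\<open>wt\<close>.
\<close>

lemma act_convex_hull:
  assumes A: "A \<in> lorentz" and L: "L \<subseteq> S2" "act A ` L \<subseteq> L" and x: "x \<in> convex hull L"
  shows "act A x \<in> convex hull L"
proof -
  have "convex {x \<in> closed_ball. act A x \<in> convex hull L}"
  proof (rule convexI)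
    fix x y :: "real^4" and u v :: real
    assume *: "x \<in> {x \<in> closed_ball. act A x \<in> convex hull L}" "y \<in> {x \<in> closed_ball. act A x \<in> convex hull L}"
      and uv: "0 \<le> u" "0 \<le> v" "u + v = 1"
    let ?z = "u *\<^sub>R x + v *\<^sub>R y"
    have z: "?z \<in> closed_ball" using * uv convex_closed_ball by (simp add: convexD)
    have pos: "wt A x > 0" "wt A y > 0" "wt A ?z > 0" using * z wt_pos[OF A] by auto
    have wz: "wt A ?z = u * wt A x + v * wt A y" by (simp add: wt_linear)
    have "wt A ?z *\<^sub>R act A ?z = (u * wt A x) *\<^sub>R act A x + (v * wt A y) *\<^sub>R act A y"
      using * z A by (simp add: matrix_vector_right_distrib matrix_vector_mult_scaleR flip: mult_act)
         (simp add: mult_act)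
    moreover have "act A ?z = (1 / wt A ?z) *\<^sub>R (wt A ?z *\<^sub>R act A ?z)" using pos by simp
    ultimately have "act A ?z = (1 / wt A ?z) *\<^sub>R ((u * wt A x) *\<^sub>R act A x + (v * wt A y) *\<^sub>R act A y)"
      by presburger
    then have e: "act A ?z = (u * wt A x / wt A ?z) *\<^sub>R act A x + (v * wt A y / wt A ?z) *\<^sub>R act A y"
      by (simp add: scaleR_add_right)
    have "(u * wt A x / wt A ?z) + (v * wt A y / wt A ?z) = 1"
      using pos(3) by (simp add: wz add_divide_distrib[symmetric])
    then have "act A ?z \<in> convex hull L"
      unfolding e using * uv pos by (intro convexD[OF convex_convex_hull]) auto
    then show "?z \<in> {x \<in> closed_ball. act A x \<in> convex hull L}" using z by simp
  qed
  moreover have "L \<subseteq> {x \<in> closed_ball. act A x \<in> convex hull L}"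
    using L by (auto simp: S2_closed_ball subset_iff hull_inc)
  ultimately have "convex hull L \<subseteq> {x \<in> closed_ball. act A x \<in> convex hull L}" 
    by (intro hull_minimal)
  then show ?thesis using x by auto
qed

section \<open>Subgroups as sets of matrices\<close>

lemma subgroup_lorentz: "subgroup G Isom_plus \<Longrightarrow> g \<in> G \<Longrightarrow> g \<in> lorentz"
  using subgroup.subset by (fastforce simp: Isom_plus_def)

lemma subgroup_mult: "subgroup G Isom_plus \<Longrightarrow> g \<in> G \<Longrightarrow> h \<in> G \<Longrightarrow> g ** h \<in> G"
  using subgroup.m_closed[of G Isom_plus g h] by (simp add: Isom_plus_def)

lemma subgroup_one: "subgroup G Isom_plus \<Longrightarrow> mat 1 \<in> G"
  using subgroup.one_closed[of G Isom_plus] by (simp add: Isom_plus_def)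

lemma subgroup_inverse:
  assumes "subgroup G Isom_plus" "g \<in> G"
  obtains h where "h \<in> G" "h ** g = mat 1" "g ** h = mat 1"
proof -
  have c: "g \<in> carrier Isom_plus" using assms subgroup.subset by blast
  have "inv\<^bsub>Isom_plus\<^esub> g \<in> G" using assms by (rule subgroup.m_inv_closed)
  moreover have "inv\<^bsub>Isom_plus\<^esub> g ** g = mat 1" "g ** inv\<^bsub>Isom_plus\<^esub> g = mat 1"
    using group.l_inv[OF group_Isom_plus c] group.r_inv[OF group_Isom_plus c]
    by (simp_all add: Isom_plus_def)
  ultimately show thesis using that by blast
qed

lemma act_inj:
  assumes "subgroup G Isom_plus" "g \<in> G" "x \<in> closed_ball" "y \<in> closed_ball" "act g x = act g y"
  shows "x = y"
  by (metis act_inverse assms subgroup_inverse subgroup_lorentz)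

lemma orb_act:
  assumes G: "subgroup G Isom_plus" and g: "g \<in> G" and x: "x \<in> closed_ball"
  shows "orb G (act g x) = orb G x"
proof -
  have sub: "orb G (act g x) \<subseteq> orb G x" if "g \<in> G" "x \<in> closed_ball" for g x
    using that unfolding orb_def
    by (auto simp flip: act_mult(1)[OF subgroup_lorentz[OF G] subgroup_lorentz[OF G]] intro: subgroup_mult[OF G])
  obtain h where h: "h \<in> G" "h ** g = mat 1" using subgroup_inverse[OF G g] by blast
  have "act h (act g x) = x" using act_inverse[OF _ _ h(2) x] subgroup_lorentz[OF G] g h by blast
  then show ?thesis
    using sub[OF g x] sub[OF h(1), of "act g x"] act_closed_ball[OF subgroup_lorentz[OF G g] x] by auto
qed

section \<open>Limit sets\<close>

text \<open>
  \<open>(wt (f i) x)\<^sup>2 * mink p p\<close>, with \<open>p = act (f i) x\<close>, equals the constant \<open>mink x x\<close>, while \<open>mink p p\<close> tends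
  to 0 when \<open>p\<close> tends to the sphere.
\<close>

lemma wt_at_top:
  assumes f: "\<And>i. f i \<in> lorentz" and x: "x \<in> H3" and \<xi>: "\<xi> \<in> S2"
    and lim: "(\<lambda>i. act (f i) x) \<longlonglongrightarrow> \<xi>"
  shows "filterlim (\<lambda>i. wt (f i) x) at_top sequentially"
proof -
  define c where "c = - mink x x"
  have c: "c > 0" using x by (simp add: c_def H3_def)
  have pos: "wt (f i) x > 0" for i using wt_pos f x H3_closed_ball by blast
  have eq: "inverse (wt (f i) x) = sqrt (- mink (act (f i) x) (act (f i) x) / c)" for i
  proof -
    have "c = (wt (f i) x)\<^sup>2 * - mink (act (f i) x) (act (f i) x)"
      using mink_act[OF f[of i], of x x] x by (simp add: c_def H3_closed_ball power2_eq_square)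
    moreover have "c / (wt (f i) x)\<^sup>2 / c = (inverse (wt (f i) x))\<^sup>2"
      using c by (simp add: power_inverse divide_inverse)
    ultimately have "- mink (act (f i) x) (act (f i) x) / c = (inverse (wt (f i) x))\<^sup>2"
      using pos[of i] by simp
    then show ?thesis using pos[of i] by simp
  qed
  have "(\<lambda>i. sqrt (- mink (act (f i) x) (act (f i) x) / c)) \<longlonglongrightarrow> sqrt (- mink \<xi> \<xi> / c)"
    using c by (intro tendsto_intros lim) auto
  then have "(\<lambda>i. inverse (wt (f i) x)) \<longlonglongrightarrow> 0" using \<xi> by (simp add: eq S2_def)
  then have "filterlim (\<lambda>i. inverse (inverse (wt (f i) x))) at_top sequentially"
    using pos by (intro filterlim_inverse_at_top) auto
  then show ?thesis by simp
qed

text \<open>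
  The convergence dynamics of a sequence of isometries: by \<open>dist_act_power2_le\<close>, the images of two
  points merge as soon as the product of their dilation factors is unbounded.
\<close>

lemma tendsto_act_transfer:
  assumes f: "\<And>i. f i \<in> lorentz" and x: "x \<in> closed_ball" and y: "y \<in> closed_ball"
    and lim: "(\<lambda>i. act (f i) x) \<longlonglongrightarrow> \<xi>"
    and wt: "filterlim (\<lambda>i. wt (f i) x * wt (f i) y) at_top sequentially"
  shows "(\<lambda>i. act (f i) y) \<longlonglongrightarrow> \<xi>"
proof -
  have "(\<lambda>i. 2 * (- mink x y) / (wt (f i) x * wt (f i) y)) \<longlonglongrightarrow> 0"
    by (rule real_tendsto_divide_at_top[OF tendsto_const wt])
  then have "(\<lambda>i. (dist (act (f i) x) (act (f i) y))\<^sup>2) \<longlonglongrightarrow> 0"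
    by (rule tendsto_sandwich[OF _ _ tendsto_const, rotated 2])
      (intro always_eventually allI zero_le_power2 dist_act_power2_le[OF f x y])+
  from tendsto_real_sqrt[OF this] have "(\<lambda>i. dist (act (f i) x) (act (f i) y)) \<longlonglongrightarrow> 0" by simp
  then have "(\<lambda>i. act (f i) x - act (f i) y) \<longlonglongrightarrow> 0"
    by (simp add: dist_norm tendsto_norm_zero_iff)
  from tendsto_diff[OF lim this] show ?thesis by simp
qed

lemma tendsto_act_H3:
  assumes f: "\<And>i. f i \<in> lorentz" and x: "x \<in> H3" and y: "y \<in> H3" and \<xi>: "\<xi> \<in> S2"
    and lim: "(\<lambda>i. act (f i) x) \<longlonglongrightarrow> \<xi>"
  shows "(\<lambda>i. act (f i) y) \<longlonglongrightarrow> \<xi>"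
proof (rule tendsto_act_transfer[OF f _ _ lim])
  show "x \<in> closed_ball" "y \<in> closed_ball" using x y by (auto simp: H3_closed_ball)
  have pos: "sqrt (- mink y y) > 0" using y by (simp add: H3_def)
  have "filterlim (\<lambda>i. sqrt (- mink y y) * wt (f i) x) at_top sequentially"
    using wt_at_top[OF f x \<xi> lim] pos by (intro filterlim_tendsto_pos_mult_at_top[OF tendsto_const])
  then show "filterlim (\<lambda>i. wt (f i) x * wt (f i) y) at_top sequentially"
  proof (rule filterlim_at_top_mono, intro always_eventually allI)
    fix i
    show "sqrt (- mink y y) * wt (f i) x \<le> wt (f i) x * wt (f i) y"
      using wt_H3_ge[OF f[of i] y] wt_pos[OF f[of i] H3_closed_ball[OF x]] by (simp add: mult.commute)
  qed
qed

text \<open>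
  The limit set can be tested on the single orbit of \<^const>\<open>origin\<close>, and by convergence instead of
  accumulation, because the orbit lies in \<^const>\<open>H3\<close> and never meets its limit.
\<close>

lemma limit_set_iff:
  assumes G: "subgroup G Isom_plus"
  shows "\<xi> \<in> limit_set G \<longleftrightarrow>
    \<xi> \<in> S2 \<and> (\<exists>f::nat \<Rightarrow> real^4^4. (\<forall>i. f i \<in> G) \<and> (\<lambda>i. act (f i) origin) \<longlonglongrightarrow> \<xi>)"
proof
  assume "\<xi> \<in> limit_set G"
  then obtain x where \<xi>: "\<xi> \<in> S2" and x: "x \<in> H3" and lim: "\<xi> islimpt orb G x"
    by (auto simp: limit_set_def)
  obtain s where s: "\<And>i::nat. s i \<in> orb G x" "s \<longlonglongrightarrow> \<xi>"
    using lim unfolding islimpt_sequential by blast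
  have "\<forall>i. \<exists>g\<in>G. s i = act g x" using s(1) by (auto simp: orb_def)
  then obtain f where f: "\<And>i. f i \<in> G" "\<And>i. s i = act (f i) x" by metis
  have "(\<lambda>i. act (f i) origin) \<longlonglongrightarrow> \<xi>"
  proof (rule tendsto_act_H3[OF _ x origin_H3 \<xi>])
    show "(\<lambda>i. act (f i) x) \<longlonglongrightarrow> \<xi>" using s(2) by (simp flip: f(2))
  qed (rule subgroup_lorentz[OF G f(1)])
  then show "\<xi> \<in> S2 \<and> (\<exists>f::nat \<Rightarrow> real^4^4. (\<forall>i. f i \<in> G) \<and> (\<lambda>i. act (f i) origin) \<longlonglongrightarrow> \<xi>)"
    using \<xi> f(1) by blast
next
  assume "\<xi> \<in> S2 \<and> (\<exists>f::nat \<Rightarrow> real^4^4. (\<forall>i. f i \<in> G) \<and> (\<lambda>i. act (f i) origin) \<longlonglongrightarrow> \<xi>)"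
  then obtain f :: "nat \<Rightarrow> real^4^4" where \<xi>: "\<xi> \<in> S2" and f: "\<And>i. f i \<in> G"
    and lim: "(\<lambda>i. act (f i) origin) \<longlonglongrightarrow> \<xi>" by blast
  have "act (f i) origin \<in> orb G origin - {\<xi>}" for i
  proof -
    have "act (f i) origin \<in> H3" by (rule act_H3[OF subgroup_lorentz[OF G f] origin_H3])
    then show ?thesis using f[of i] \<xi> by (auto simp: orb_def H3_def S2_def)
  qed
  then have "\<xi> islimpt orb G origin" unfolding islimpt_sequential
    using lim by (intro exI[of _ "\<lambda>i. act (f i) origin"]) auto
  then show "\<xi> \<in> limit_set G" using \<xi> origin_H3 by (auto simp: limit_set_def)
qed

lemma limit_set_S2: "limit_set G \<subseteq> S2"
  by (auto simp: limit_set_def)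

lemma compact_limit_set:
  assumes G: "subgroup G Isom_plus" shows "compact (limit_set G)"
proof -
  have "limit_set G = S2 \<inter> closure (orb G origin)"
  proof (intro equalityI subsetI)
    fix \<xi> assume "\<xi> \<in> S2 \<inter> closure (orb G origin)"
    then have \<xi>: "\<xi> \<in> S2" and "\<xi> \<in> closure (orb G origin)" by auto
    then obtain s where s: "\<And>i::nat. s i \<in> orb G origin" "s \<longlonglongrightarrow> \<xi>"
      unfolding closure_sequential by auto
    have "\<forall>i. \<exists>g\<in>G. s i = act g origin" using s(1) by (auto simp: orb_def)
    then obtain f where "\<And>i. f i \<in> G" "\<And>i. s i = act (f i) origin" by metis
    then have "s = (\<lambda>i. act (f i) origin)" by blast
    then show "\<xi> \<in> limit_set G"
      using \<xi> s(2) \<open>\<And>i. f i \<in> G\<close> unfolding limit_set_iff[OF G] by blast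
  next
    fix \<xi> assume "\<xi> \<in> limit_set G"
    then obtain f :: "nat \<Rightarrow> real^4^4" where S: "\<xi> \<in> S2" and f: "\<And>i. f i \<in> G"
      and lim: "(\<lambda>i. act (f i) origin) \<longlonglongrightarrow> \<xi>" unfolding limit_set_iff[OF G] by blast
    have "\<xi> \<in> closure (orb G origin)"
      unfolding closure_sequential using f lim
      by (intro exI[of _ "\<lambda>i. act (f i) origin"]) (auto simp: orb_def)
    then show "\<xi> \<in> S2 \<inter> closure (orb G origin)" using S by blast
  qed
  then show ?thesis using compact_S2 by (simp add: compact_Int_closed)
qed

lemma act_limit_set:
  assumes G: "subgroup G Isom_plus" and g: "g \<in> G" and \<xi>: "\<xi> \<in> limit_set G"
  shows "act g \<xi> \<in> limit_set G"
proof -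
  obtain f :: "nat \<Rightarrow> real^4^4" where S: "\<xi> \<in> S2" and f: "\<And>i. f i \<in> G"
    and lim: "(\<lambda>i. act (f i) origin) \<longlonglongrightarrow> \<xi>" using \<xi> unfolding limit_set_iff[OF G] by blast
  have lor: "g \<in> lorentz" "f i \<in> lorentz" for i using subgroup_lorentz[OF G] f g by auto
  have "(\<lambda>i. act g (act (f i) origin)) \<longlonglongrightarrow> act g \<xi>"
    using act_closed_ball[OF lor(2) H3_closed_ball[OF origin_H3]] S2_closed_ball[OF S]
    by (intro continuous_on_tendsto_compose[OF continuous_act[OF lor(1)] lim]) auto
  then have "(\<lambda>i. act (g ** f i) origin) \<longlonglongrightarrow> act g \<xi>"
    by (simp add: act_mult lor H3_closed_ball origin_H3)
  then show ?thesis
    using act_S2[OF lor(1) S] subgroup_mult[OF G g f] unfolding limit_set_iff[OF G]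
    by (intro conjI exI[of _ "\<lambda>i. g ** f i"]) auto
qed

lemma limit_set_mono: "G \<subseteq> H \<Longrightarrow> limit_set G \<subseteq> limit_set H"
  unfolding limit_set_def orb_def by (blast intro: islimpt_subset image_mono)

section \<open>Compact subsets of orbit spaces\<close>

lemma compactin_orbit_space:
  assumes "compact Q" "Q \<subseteq> X" shows "compactin (orbit_space G X) (orb G ` Q)"
  using assms
  by (intro image_compactin[OF _ quotient_imp_continuous_map[OF quotient_map_orbit_space]])
    (simp add: compactin_subtopology)

text \<open>
  The images of the sets \<open>{x. \<exists>g\<in>G. 1 / (k + 1) < - mink (act g x) (act g x)}\<close> form an
  increasing open cover of the quotient, and \<open>- mink x x\<close> measures how far a point of \<^const>\<open>H3\<close> is
  from the sphere at infinity.
\<close>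

lemma compactin_orbit_space_thick:
  assumes G: "subgroup G Isom_plus" and K: "K \<subseteq> H3"
    and cpt: "compactin (orbit_space G H3) (orb G ` K)"
  obtains \<eta> where "\<eta> > 0" "\<And>x. x \<in> K \<Longrightarrow> \<exists>g\<in>G. \<eta> \<le> - mink (act g x) (act g x)"
proof -
  define V where "V k = {x \<in> H3. \<exists>g\<in>G. 1 / real (Suc k) < - mink (act g x) (act g x)}" for k
  have openV: "openin (top_of_set H3) (V k)" for k
  proof -
    have "V k = (\<Union>g\<in>G. H3 \<inter> (\<lambda>x. - mink (act g x) (act g x)) -` {1 / real (Suc k)<..})"
      by (auto simp: V_def)
    moreover have "openin (top_of_set H3) (H3 \<inter> (\<lambda>x. - mink (act g x) (act g x)) -` {1 / real (Suc k)<..})"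
      if "g \<in> G" for g
      using continuous_on_subset[OF continuous_act[OF subgroup_lorentz[OF G that]]] H3_closed_ball
      by (intro continuous_openin_preimage_gen continuous_intros) auto
    ultimately show ?thesis by (simp only:) (rule openin_Union, blast)
  qed
  have sat: "{x \<in> topspace (top_of_set H3). orb G x \<in> orb G ` V k} = V k" for k
  proof (intro equalityI subsetI)
    fix x assume "x \<in> {x \<in> topspace (top_of_set H3). orb G x \<in> orb G ` V k}"
    then obtain y g where x: "x \<in> H3" and y: "orb G x = orb G y" and g: "g \<in> G"
      "1 / real (Suc k) < - mink (act g y) (act g y)" by (auto simp: V_def)
    have "act g y \<in> orb G x" unfolding y using g by (auto simp: orb_def)
    then obtain h where "h \<in> G" "act g y = act h x" by (auto simp: orb_def)
    then show "x \<in> V k" using g x by (auto simp: V_def)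
  qed (auto simp: V_def)
  have openU: "openin (orbit_space G H3) (orb G ` V k)" for k
  proof -
    have "orb G ` V k \<subseteq> topspace (orbit_space G H3)"
      using quotient_imp_surjective_map[OF quotient_map_orbit_space[of H3 G]] by (auto simp: V_def)
    then have "openin (top_of_set H3) {x \<in> topspace (top_of_set H3). orb G x \<in> orb G ` V k}
        \<longleftrightarrow> openin (orbit_space G H3) (orb G ` V k)"
      using quotient_map_orbit_space[of H3 G] unfolding quotient_map_def by blast
    then show ?thesis unfolding sat using openV by blast
  qed
  have cover: "orb G ` K \<subseteq> \<Union> (range (\<lambda>k. orb G ` V k))"
  proof -
    have "\<exists>k. x \<in> V k" if "x \<in> K" for x
    proof -
      have x: "x \<in> H3" using that K by auto
      then have "- mink x x > 0" by (simp add: H3_def)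
      then obtain k where "1 / real (Suc k) < - mink x x"
        by (metis nat_approx_posE)
      then show ?thesis using x subgroup_one[OF G] act_one[OF H3_closed_ball[OF x]] unfolding V_def by force
    qed
    then show ?thesis by blast
  qed
  have "openin (orbit_space G H3) U" if "U \<in> range (\<lambda>k. orb G ` V k)" for U
    using that openU by blast
  from compactinD[OF cpt this cover]
  obtain F where F: "finite F" "F \<subseteq> range (\<lambda>k. orb G ` V k)" "orb G ` K \<subseteq> \<Union>F"
    by blast
  obtain I where I: "finite I" "F = (\<lambda>k. orb G ` V k) ` I"
    using finite_subset_image[OF F(1,2)] by blast
  obtain m where m: "\<And>k. k \<in> I \<Longrightarrow> k \<le> m" using I(1) finite_nat_set_iff_bounded_le by auto
  show thesis
  proof (rule that[of "1 / real (Suc m)"])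
    fix x assume x: "x \<in> K"
    then obtain k where k: "k \<in> I" "orb G x \<in> orb G ` V k" using F(3) I(2) by blast
    then have "x \<in> V k" using sat[of k] x K by auto
    then obtain g where g: "g \<in> G" "1 / real (Suc k) < - mink (act g x) (act g x)" by (auto simp: V_def)
    have "1 / real (Suc m) \<le> 1 / real (Suc k)" using m[OF k(1)] by (simp add: field_simps)
    then show "\<exists>g\<in>G. 1 / real (Suc m) \<le> - mink (act g x) (act g x)" using g by force
  qed simp
qed

section \<open>Supporting planes with thick faces\<close>

text \<open>
  On the sphere \<open>- mink u v\<close> is half the square of the Euclidean distance.
\<close>

definition separated :: "real \<Rightarrow> real ^ 4 \<Rightarrow> real ^ 4 \<Rightarrow> real ^ 4 \<Rightarrow> bool" where
  "separated \<delta> a b c \<longleftrightarrow> \<delta> \<le> - mink a b \<and> \<delta> \<le> - mink b c \<and> \<delta> \<le> - mink a c"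

text \<open>
  The Gram matrix of \<open>a, b, c, m\<close> has determinant \<open>2 * mink a b * mink b c * mink a c\<close>, so these
  vectors form a basis and the form is nondegenerate.
\<close>

lemma orthogonal_to_frame_zero:
  assumes S: "a \<in> S2" "b \<in> S2" "c \<in> S2" and ne: "mink a b \<noteq> 0" "mink b c \<noteq> 0" "mink a c \<noteq> 0"
    and m: "mink m m = 1" "mink m a = 0" "mink m b = 0" "mink m c = 0"
    and w: "mink w a = 0" "mink w b = 0" "mink w c = 0" "mink w m = 0"
  shows "w = 0"
proof -
  define X :: "real^4^4" where
    "X = (\<chi> i j. (if j = 1 then a else if j = 2 then b else if j = 3 then c else m) $ i)"
  have col: "column 1 X = a" "column 2 X = b" "column 3 X = c" "column 4 X = m"
    by (simp_all add: X_def column_def)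
  have "v = 0" if v: "X *v v = 0" for v
  proof -
    have z: "v$1 *\<^sub>R a + v$2 *\<^sub>R b + v$3 *\<^sub>R c + v$4 *\<^sub>R m = 0"
      using v by (simp add: matrix_mult_sum sum_4 col scalar_mult_eq_scaleR)
    have pair: "v$1 * mink a y + v$2 * mink b y + v$3 * mink c y + v$4 * mink m y = 0" for y
      using arg_cong[OF z, of "\<lambda>x. mink x y"] by (simp add: mink_linear(1,3)) (simp add: mink_def)
    have self: "mink a a = 0" "mink b b = 0" "mink c c = 0" using S by (auto simp: S2_def)
    have sym: "mink b a = mink a b" "mink c a = mink a c" "mink c b = mink b c"
      "mink a m = mink m a" "mink b m = mink m b" "mink c m = mink m c" by (simp_all add: mink_linear(7))
    have v4: "v $ 4 = 0" using pair[of m] m sym by simp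
    have e: "v$2 * mink a b + v$3 * mink a c = 0" "v$1 * mink a b + v$3 * mink b c = 0"
      "v$1 * mink a c + v$2 * mink b c = 0"
      using pair[of a] pair[of b] pair[of c] m self sym by simp_all
    have "2 * (v$1 * mink a b * mink a c) = (v$1 * mink a b + v$3 * mink b c) * mink a c
        + (v$1 * mink a c + v$2 * mink b c) * mink a b - (v$2 * mink a b + v$3 * mink a c) * mink b c"
      by (simp add: algebra_simps)
    then have v1: "v $ 1 = 0" using e ne by simp
    then show ?thesis using e ne v4 by (simp add: vec_eq_iff forall_4)
  qed
  then have "det X \<noteq> 0"
    by (metis invertible_det_nz invertible_left_inverse matrix_left_invertible_ker)
  moreover have "det J \<noteq> 0" using JJ by (metis det_I det_mul mult_zero_left zero_neq_one)
  ultimately have "det (transpose X ** J) \<noteq> 0" by (simp add: det_mul)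
  moreover have "(transpose X *v (J *v w)) $ i = 0" for i
    using exhaust_4[of i] w unfolding transpose_J by (auto simp: col)
  then have "(transpose X ** J) *v w = 0"
    by (simp only: vec_eq_iff matrix_vector_mul_assoc zero_index) simp
  ultimately show ?thesis
    by (metis invertible_det_nz invertible_left_inverse matrix_left_invertible_ker)
qed

text \<open>
  The plane orthogonal to \<open>m\<close> contains the midpoint \<open>q\<close> of \<open>a\<close> and \<open>b\<close>, which stays away from the
  sphere; normals of planes through a compact part of \<^const>\<open>H3\<close> are bounded.
\<close>

lemma normal_bounded:
  assumes S: "a \<in> S2" "b \<in> S2" and \<delta>: "\<delta> > 0" "\<delta> \<le> - mink a b"
    and m: "mink m m = 1" "mink m a = 0" "mink m b = 0"
  shows "(norm m)\<^sup>2 \<le> 4 / \<delta>"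
proof -
  define q where "q = (1/2) *\<^sub>R (a + b)"
  define n2 q2 where "n2 = m$1*m$1 + m$2*m$2 + m$3*m$3" and "q2 = q$1*q$1 + q$2*q$2 + q$3*q$3"
  have q4: "q $ 4 = 1" using S by (simp add: q_def S2_def)
  have "mink q q = mink a b / 2" using S by (simp add: q_def mink_linear(1-4) mink_linear(7)[of b a] S2_def)
  then have "q2 \<le> 1 - \<delta> / 2" using \<delta> q4 by (simp add: mink_def q2_def)
  have n2: "n2 = 1 + m$4 * m$4" using m(1) by (simp add: mink_def n2_def)
  have "mink m q = 0" using m by (simp add: q_def mink_linear(1-4))
  then have m4: "m$4 = m$1*q$1 + m$2*q$2 + m$3*q$3" using q4 by (simp add: mink_def)
  have "n2 * q2 - (m$1*q$1 + m$2*q$2 + m$3*q$3)\<^sup>2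
      = (m$1*q$2 - m$2*q$1)\<^sup>2 + (m$1*q$3 - m$3*q$1)\<^sup>2 + (m$2*q$3 - m$3*q$2)\<^sup>2"
    by (simp add: n2_def q2_def power2_eq_square algebra_simps)
  also have "\<dots> \<ge> 0" by simp
  finally have "m$4 * m$4 \<le> n2 * q2" by (simp add: m4 power2_eq_square)
  also have "\<dots> \<le> n2 * (1 - \<delta> / 2)"
    using \<open>q2 \<le> 1 - \<delta> / 2\<close> n2 by (intro mult_left_mono) auto
  finally have "n2 * (\<delta> / 2) \<le> 1" using n2 by (simp add: algebra_simps)
  then have "n2 \<le> 2 / \<delta>" using \<delta> by (simp add: field_simps)
  then show ?thesis using n2 by (simp add: norm_power2_4 n2_def)
qed

text \<open>
  If there were infinitely many such normals, a sequence \<open>n i\<close> of them would converge to some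
  \<open>m\<close> different from all of them, with thick triangles \<open>a i, b i, c i\<close> converging to a thick
  triangle \<open>A, B, C\<close> in the plane of \<open>m\<close>.  As the \<open>i\<close>th plane supports \<open>\<Lambda>\<close>, the form \<open>n i - m\<close> is
  nonnegative on \<open>A, B, C\<close>; as \<open>m\<close> supports \<open>\<Lambda>\<close> too, it is nonpositive on \<open>a i, b i, c i\<close>.  So a
  limit \<open>W\<close> of the normalized differences is orthogonal to \<open>A, B, C\<close>.  It is also orthogonal
  to \<open>m\<close>, being tangent to the quadric of unit normals, and therefore vanishes.
\<close>

lemma finite_thick_supports:
  assumes \<Lambda>: "\<Lambda> \<subseteq> S2" "compact \<Lambda>" and \<delta>: "\<delta> > 0"
  shows "finite {m. mink m m = 1 \<and> (\<forall>v\<in>\<Lambda>. 0 \<le> mink m v) \<and>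
    (\<exists>a\<in>\<Lambda>. \<exists>b\<in>\<Lambda>. \<exists>c\<in>\<Lambda>. separated \<delta> a b c \<and> mink m a = 0 \<and> mink m b = 0 \<and> mink m c = 0)}" (is "finite ?N")
proof (rule ccontr)
  assume inf: "infinite ?N"
  have "?N \<subseteq> cball 0 (sqrt (4 / \<delta>))"
  proof
    fix m assume "m \<in> ?N"
    then have "(norm m)\<^sup>2 \<le> 4 / \<delta>"
      using normal_bounded[OF _ _ \<delta>] \<Lambda> unfolding separated_def by blast
    then show "m \<in> cball 0 (sqrt (4 / \<delta>))" by (simp add: real_le_rsqrt)
  qed
  then obtain m where "m islimpt ?N"
    using inf compact_cball unfolding compact_eq_Bolzano_Weierstrass by meson
  then obtain n where n: "\<And>i::nat. n i \<in> ?N - {m}" and lim_n: "n \<longlonglongrightarrow> m"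
    unfolding islimpt_sequential by blast
  have n1: "mink (n i) (n i) = 1" "\<And>v. v \<in> \<Lambda> \<Longrightarrow> 0 \<le> mink (n i) v" for i using n[of i] by auto
  have "\<forall>i. \<exists>a b c. a \<in> \<Lambda> \<and> b \<in> \<Lambda> \<and> c \<in> \<Lambda> \<and> \<delta> \<le> - mink a b \<and> \<delta> \<le> - mink b c \<and> \<delta> \<le> - mink a c \<and>
      mink (n i) a = 0 \<and> mink (n i) b = 0 \<and> mink (n i) c = 0"
    using n unfolding separated_def by blast
  then obtain a b c where abc: "\<And>i. a i \<in> \<Lambda>" "\<And>i. b i \<in> \<Lambda>" "\<And>i. c i \<in> \<Lambda>"
    "\<And>i. \<delta> \<le> - mink (a i) (b i)" "\<And>i. \<delta> \<le> - mink (b i) (c i)" "\<And>i. \<delta> \<le> - mink (a i) (c i)"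
    "\<And>i. mink (n i) (a i) = 0" "\<And>i. mink (n i) (b i) = 0" "\<And>i. mink (n i) (c i) = 0" by metis
  define w where "w i = (1 / norm (n i - m)) *\<^sub>R (n i - m)" for i
  have nm: "norm (n i - m) > 0" for i using n[of i] by auto
  have "w i \<in> sphere 0 1" for i using nm[of i] by (simp add: w_def)
  then have "\<forall>i. (a i, b i, c i, w i) \<in> \<Lambda> \<times> \<Lambda> \<times> \<Lambda> \<times> sphere 0 1" using abc by auto
  moreover have "compact (\<Lambda> \<times> \<Lambda> \<times> \<Lambda> \<times> sphere (0::real^4) 1)"
    using \<Lambda> by (intro compact_Times compact_sphere)
  ultimately obtain l r where l: "l \<in> \<Lambda> \<times> \<Lambda> \<times> \<Lambda> \<times> sphere (0::real^4) 1" and r: "strict_mono (r::nat\<Rightarrow>nat)"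
    and lim: "((\<lambda>i. (a i, b i, c i, w i)) \<circ> r) \<longlonglongrightarrow> l"
    unfolding compact_def by meson
  obtain A B C W where lABC: "l = (A, B, C, W)" by (metis surj_pair)
  have limits: "(\<lambda>i. a (r i)) \<longlonglongrightarrow> A" "(\<lambda>i. b (r i)) \<longlonglongrightarrow> B" "(\<lambda>i. c (r i)) \<longlonglongrightarrow> C" "(\<lambda>i. w (r i)) \<longlonglongrightarrow> W"
    using tendsto_fst[OF lim] tendsto_fst[OF tendsto_snd[OF lim]]
      tendsto_fst[OF tendsto_snd[OF tendsto_snd[OF lim]]] tendsto_snd[OF tendsto_snd[OF tendsto_snd[OF lim]]]
    by (simp_all add: lABC o_def)
  have limr: "(\<lambda>i. n (r i)) \<longlonglongrightarrow> m" using LIMSEQ_subseq_LIMSEQ[OF lim_n r] by (simp add: o_def)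
  have mem: "A \<in> \<Lambda>" "B \<in> \<Lambda>" "C \<in> \<Lambda>" "norm W = 1" using l lABC by auto
  have m0: "0 \<le> mink m v" if "v \<in> \<Lambda>" for v
    by (rule tendsto_lowerbound[OF tendsto_mink[OF limr tendsto_const]]) (auto simp: n1 that)
  have "(\<lambda>i. mink (n (r i)) (n (r i))) \<longlonglongrightarrow> mink m m" by (intro tendsto_mink limr)
  then have m1: "mink m m = 1" by (simp add: n1(1) LIMSEQ_const_iff)
  have vert: "mink m P = 0 \<and> mink W P = 0"
    if p: "\<And>i. p i \<in> \<Lambda>" "\<And>i. mink (n i) (p i) = 0" "(\<lambda>i. p (r i)) \<longlonglongrightarrow> P" "P \<in> \<Lambda>" for p P
  proof
    have "(\<lambda>i. mink (n (r i)) (p (r i))) \<longlonglongrightarrow> mink m P" by (intro tendsto_mink limr p)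
    then show mP: "mink m P = 0" by (simp add: p(2) LIMSEQ_const_iff)
    have "mink (w i) (p i) \<le> 0" for i
      using m0[OF p(1)[of i]] nm[of i] by (simp add: w_def mink_linear(1,5) p(2) divide_nonneg_pos)
    then have 1: "mink W P \<le> 0"
      by (intro tendsto_upperbound[OF tendsto_mink[OF limits(4) p(3)]]) auto
    have "mink (w i) P \<ge> 0" for i
      using n1(2)[OF p(4), of i] nm[of i] by (simp add: w_def mink_linear(1,5) mP)
    then have "0 \<le> mink W P"
      by (intro tendsto_lowerbound[OF tendsto_mink[OF limits(4) tendsto_const]]) auto
    with 1 show "mink W P = 0" by simp
  qed
  have "mink (n i - m) (n i + m) = 0" for i
    using mink_linear(7)[of m "n i"] by (simp add: mink_linear(3-6) n1(1) m1)
  then have "mink (w i) (n i + m) = 0" for i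
    by (simp only: w_def mink_linear(1) mult_zero_right)
  moreover have "(\<lambda>i. mink (w (r i)) (n (r i) + m)) \<longlonglongrightarrow> mink W (m + m)"
    by (intro tendsto_intros limits limr)
  ultimately have "mink W (m + m) = 0" by (simp only: LIMSEQ_const_iff)
  then have Wm: "mink W m = 0" using mink_linear(4)[of W m m] by linarith
  have sep: "\<delta> \<le> - mink P Q" if "\<And>i. \<delta> \<le> - mink (p i) (q i)" "(\<lambda>i. p (r i)) \<longlonglongrightarrow> P" "(\<lambda>i. q (r i)) \<longlonglongrightarrow> Q" for p q P Q
    by (rule tendsto_lowerbound[OF tendsto_minus[OF tendsto_mink[OF that(2,3)]]]) (auto simp: that(1))
  have "W = 0"
    using sep[OF abc(4) limits(1,2)] sep[OF abc(5) limits(2,3)] sep[OF abc(6) limits(1,3)] \<delta> mem \<Lambda>(1)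
      vert[OF abc(1,7) limits(1)] vert[OF abc(2,8) limits(2)] vert[OF abc(3,9) limits(3)] m1 Wm
    by (intro orthogonal_to_frame_zero[of A B C m W]) auto
  then show False using mem(4) by simp
qed

section \<open>Horospherical points and cocompactness on triples\<close>

text \<open>
  Since \<open>wt g \<xi> = - mink (h *v origin) \<xi>\<close> for the inverse \<open>h\<close> of \<open>g\<close>, this says that the orbit of
  \<^const>\<open>origin\<close> enters every horoball centred at \<open>\<xi>\<close>.
\<close>

definition horospherical :: "(real ^ 4 ^ 4) set \<Rightarrow> real ^ 4 \<Rightarrow> bool" where
  "horospherical G \<xi> \<longleftrightarrow> (\<forall>\<epsilon>>0. \<exists>g\<in>G. wt g \<xi> < \<epsilon>)"

text \<open>
  Triples of distinct points of \<open>L\<close> can be moved into a fixed compact set of such triples.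
\<close>

definition triple_cocompact :: "(real ^ 4 ^ 4) set \<Rightarrow> (real ^ 4) set \<Rightarrow> bool" where
  "triple_cocompact G L \<longleftrightarrow> (\<exists>\<delta>>0. \<forall>a\<in>L. \<forall>b\<in>L. \<forall>c\<in>L. a \<noteq> b \<longrightarrow> b \<noteq> c \<longrightarrow> a \<noteq> c \<longrightarrow>
    (\<exists>g\<in>G. separated \<delta> (act g a) (act g b) (act g c)))"

lemma wt_inverse:
  assumes "A \<in> lorentz" "B \<in> lorentz" "B ** A = mat 1" "x \<in> closed_ball"
  shows "wt B (act A x) = 1 / wt A x"
  using act_mult(2)[of B A x] wt_pos[of A x] assms by (simp add: wt_one field_simps)

lemma tendsto_dist_power2:
  assumes "e \<longlonglongrightarrow> (0::real)" "\<And>i. (dist (u i) l)\<^sup>2 \<le> e i" shows "u \<longlonglongrightarrow> l"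
proof -
  have "(\<lambda>i. (dist (u i) l)\<^sup>2) \<longlonglongrightarrow> 0"
    by (rule tendsto_sandwich[OF _ _ tendsto_const assms(1)]) (simp_all add: assms(2))
  from tendsto_real_sqrt[OF this] have "(\<lambda>i. dist (u i) l) \<longlonglongrightarrow> 0" by simp
  then show ?thesis by (subst tendsto_dist_iff)
qed

text \<open>
  The inverse of an element that contracts \<open>\<xi>\<close> moves \<^const>\<open>origin\<close> deep into a horoball at \<open>\<xi>\<close>,
  hence close to \<open>\<xi>\<close>.
\<close>

lemma horospherical_limit:
  assumes G: "subgroup G Isom_plus" and \<xi>: "\<xi> \<in> S2" and h: "horospherical G \<xi>"
  shows "\<xi> \<in> limit_set G"
proof -
  have "\<exists>k\<in>G. (dist (act k origin) \<xi>)\<^sup>2 \<le> 2 / real (Suc i)" for i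
  proof -
    obtain g where g: "g \<in> G" "wt g \<xi> < 1 / real (Suc i)"
      using h unfolding horospherical_def by (meson of_nat_0_less_iff zero_less_Suc zero_less_divide_1_iff)
    obtain k where k: "k \<in> G" "k ** g = mat 1" using subgroup_inverse[OF G g(1)] by blast
    have lor: "g \<in> lorentz" "k \<in> lorentz" using subgroup_lorentz[OF G] g k by auto
    have \<xi>b: "\<xi> \<in> closed_ball" by (rule S2_closed_ball[OF \<xi>])
    have gpos: "wt g \<xi> > 0" by (rule wt_pos[OF lor(1) \<xi>b])
    have k1: "wt k origin \<ge> 1" using wt_H3_ge[OF lor(2) origin_H3] by (simp add: mink_origin_self)
    have "(dist (act k origin) (act k (act g \<xi>)))\<^sup>2
        \<le> 2 * (- mink origin (act g \<xi>)) / (wt k origin * wt k (act g \<xi>))"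
      by (intro dist_act_power2_le lor act_closed_ball \<xi>b H3_closed_ball origin_H3)
    also have "\<dots> = 2 * wt g \<xi> / wt k origin"
      using gpos by (simp add: mink_origin act_nth4[OF lor(1) \<xi>b] wt_inverse[OF lor k(2) \<xi>b])
    also have "\<dots> \<le> 2 * wt g \<xi> / 1" using k1 gpos by (intro divide_left_mono) auto
    also have "\<dots> \<le> 2 / real (Suc i)" using g(2) by simp
    finally show ?thesis using k(1) act_inverse[OF lor k(2) \<xi>b] by auto
  qed
  then obtain f where f: "\<And>i. f i \<in> G" "\<And>i. (dist (act (f i) origin) \<xi>)\<^sup>2 \<le> 2 / real (Suc i)" by metis
  have "(\<lambda>i. act (f i) origin) \<longlonglongrightarrow> \<xi>"
    by (rule tendsto_dist_power2[OF _ f(2)]) (rule LIMSEQ_Suc[OF lim_const_over_n])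
  then show ?thesis unfolding limit_set_iff[OF G] using \<xi> f(1) by blast
qed

text \<open>
  For \<open>g\<close> that separates \<open>(\<xi>, a, b)\<close>, the three relations \<open>mink_act\<close> for the pairs of this triple
  determine \<open>wt g \<xi>\<close> up to bounded factors: its square is comparable to
  \<open>mink \<xi> a * mink \<xi> b / mink a b\<close>, which tends to 0 when \<open>a\<close> tends to \<open>\<xi>\<close>.
\<close>

lemma islimpt_horospherical:
  assumes G: "subgroup G Isom_plus" and L: "L \<subseteq> S2" and tc: "triple_cocompact G L"
    and \<xi>: "\<xi> \<in> L" "\<xi> islimpt L"
  shows "horospherical G \<xi>"
  unfolding horospherical_def
proof (intro allI impI)
  fix \<epsilon> :: real assume \<epsilon>: "\<epsilon> > 0"
  obtain \<delta> where \<delta>: "\<delta> > 0" and sep: "\<And>a b c. a \<in> L \<Longrightarrow> b \<in> L \<Longrightarrow> c \<in> L \<Longrightarrow> a \<noteq> b \<Longrightarrow> b \<noteq> c \<Longrightarrow> a \<noteq> c \<Longrightarrow>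
    \<exists>g\<in>G. separated \<delta> (act g a) (act g b) (act g c)" using tc unfolding triple_cocompact_def by metis
  obtain s where s: "\<And>i::nat. s i \<in> L - {\<xi>}" "s \<longlonglongrightarrow> \<xi>"
    using \<xi>(2) unfolding islimpt_sequential by blast
  define b where "b = s 0"
  have b: "b \<in> L" "b \<noteq> \<xi>" using s(1)[of 0] by (auto simp: b_def)
  have \<xi>S: "\<xi> \<in> S2" and bS: "b \<in> S2" using \<xi> b L by auto
  have "mink \<xi> b < 0" using b \<xi>S bS by (intro mink_closed_ball_neg S2_closed_ball) auto
  (* This quotient bounds the square of wt g \<xi> when g separates the triple of \<xi>, s i and b. *)
  then have "(\<lambda>i. 4 * (- mink \<xi> (s i)) / (\<delta>\<^sup>2 * - mink (s i) b)) \<longlonglongrightarrow> 4 * (- mink \<xi> \<xi>) / (\<delta>\<^sup>2 * - mink \<xi> b)"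
    using \<delta> by (intro tendsto_intros s(2)) auto
  then have "(\<lambda>i. 4 * (- mink \<xi> (s i)) / (\<delta>\<^sup>2 * - mink (s i) b)) \<longlonglongrightarrow> 0" using \<xi>S by (simp add: S2_def)
  then have "\<forall>\<^sub>F i in sequentially. 4 * (- mink \<xi> (s i)) / (\<delta>\<^sup>2 * - mink (s i) b) < \<epsilon>\<^sup>2"
    using \<epsilon> by (intro order_tendstoD) auto
  moreover have "\<forall>\<^sub>F i in sequentially. s i \<noteq> b"
    using tendsto_imp_eventually_ne[OF s(2) b(2)[symmetric]] .
  ultimately have "\<forall>\<^sub>F i in sequentially. 4 * (- mink \<xi> (s i)) / (\<delta>\<^sup>2 * - mink (s i) b) < \<epsilon>\<^sup>2 \<and> s i \<noteq> b"
    by (rule eventually_conj)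
  then obtain i where i: "4 * (- mink \<xi> (s i)) / (\<delta>\<^sup>2 * - mink (s i) b) < \<epsilon>\<^sup>2" "s i \<noteq> b"
    by (auto simp: eventually_sequentially)
  define a where "a = s i"
  have a: "a \<in> L" "a \<noteq> \<xi>" "a \<noteq> b" using s(1)[of i] i by (auto simp: a_def)
  then obtain g where g: "g \<in> G" "separated \<delta> (act g \<xi>) (act g a) (act g b)"
    using sep[of \<xi> a b] \<xi> b by auto
  have lor: "g \<in> lorentz" by (rule subgroup_lorentz[OF G g(1)])
  have cb: "\<xi> \<in> closed_ball" "a \<in> closed_ball" "b \<in> closed_ball"
    using \<xi>S bS a(1) L S2_closed_ball by auto
  define A B C where "A = - mink (act g \<xi>) (act g a)" and "B = - mink (act g \<xi>) (act g b)"
    and "C = - mink (act g a) (act g b)"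
  define x y z where "x = wt g \<xi>" and "y = wt g a" and "z = wt g b"
  have pos: "x > 0" "y > 0" "z > 0" using wt_pos[OF lor] cb by (auto simp: x_def y_def z_def)
  have AB: "A \<ge> \<delta>" "B \<ge> \<delta>" "C \<ge> \<delta>" using g(2) by (auto simp: separated_def A_def B_def C_def)
  have "C \<le> 2" unfolding C_def by (intro mink_closed_ball_ge act_closed_ball lor cb)
  have m: "- mink \<xi> a = x * y * A" "- mink \<xi> b = x * z * B" "- mink a b = y * z * C"
    using mink_act[OF lor cb(1,2)] mink_act[OF lor cb(1,3)] mink_act[OF lor cb(2,3)]
    by (auto simp: A_def B_def C_def x_def y_def z_def)
  have xb2: "x * z * B \<le> 2" using mink_closed_ball_ge[OF cb(1,3)] m by simp
  have "x\<^sup>2 * \<delta>\<^sup>2 * (y * z * C) \<le> x\<^sup>2 * (A * B) * (y * z * C)"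
    using pos AB \<delta> by (intro mult_right_mono mult_left_mono) (auto simp: power2_eq_square intro!: mult_mono)
  also have "\<dots> = (x * y * A) * ((x * z * B) * C)" by (simp add: power2_eq_square)
  also have "\<dots> \<le> (x * y * A) * (2 * 2)"
    using xb2 \<open>C \<le> 2\<close> pos AB \<delta> by (intro mult_left_mono mult_mono) auto
  finally have "x\<^sup>2 * (\<delta>\<^sup>2 * (y * z * C)) \<le> 4 * (x * y * A)" by simp
  moreover have "\<delta>\<^sup>2 * (y * z * C) > 0" using \<delta> pos AB by simp
  ultimately have "x\<^sup>2 \<le> 4 * (x * y * A) / (\<delta>\<^sup>2 * (y * z * C))" by (simp only: pos_le_divide_eq)
  also have "\<dots> < \<epsilon>\<^sup>2" using i(1) by (simp only: m flip: a_def)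
  finally have "x < \<epsilon>" by (rule power_less_imp_less_base) (use \<epsilon> in simp)
  then show "\<exists>g\<in>G. wt g \<xi> < \<epsilon>" using g(1) by (auto simp: x_def)
qed

text \<open>
  If \<open>act (f i) origin\<close> tends to \<open>\<xi>\<close>, then so does the image of the midpoint of any two points of
  \<open>L\<close>, so the sum of the dilation factors of these two points tends to infinity.  Hence among three points
  of \<open>L\<close> at least two are carried close to \<open>\<xi>\<close>, and one of the two images differs from \<open>\<xi>\<close>.
\<close>

lemma limit_set_islimpt:
  assumes G: "subgroup G Isom_plus" and L: "L \<subseteq> S2" and inv: "\<And>g u. g \<in> G \<Longrightarrow> u \<in> L \<Longrightarrow> act g u \<in> L"
    and three: "p \<in> L" "q \<in> L" "r \<in> L" "p \<noteq> q" "q \<noteq> r" "p \<noteq> r"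
    and \<xi>: "\<xi> \<in> limit_set G"
  shows "\<xi> islimpt L"
  unfolding islimpt_approachable
proof (intro allI impI)
  fix e :: real assume e: "e > 0"
  obtain f :: "nat \<Rightarrow> real^4^4" where S: "\<xi> \<in> S2" and f: "\<And>i. f i \<in> G"
    and lim: "(\<lambda>i. act (f i) origin) \<longlonglongrightarrow> \<xi>" using \<xi> unfolding limit_set_iff[OF G] by blast
  have lor: "f i \<in> lorentz" for i by (rule subgroup_lorentz[OF G f])
  (* Chosen so that 2 / R < (e / 2)^2 in the estimate of near below. *)
  define R where "R = 16 / e\<^sup>2"
  have R: "R > 0" using e by (simp add: R_def)
  have pair: "\<forall>\<^sub>F i in sequentially. wt (f i) u \<ge> R \<or> wt (f i) v \<ge> R"
    if uv: "u \<in> L" "v \<in> L" "u \<noteq> v" for u v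
  proof -
    let ?c = "(1/2) *\<^sub>R (u + v)"
    have c: "?c \<in> H3" using uv L by (intro midpoint_H3) auto
    have "filterlim (\<lambda>i. wt (f i) ?c) at_top sequentially"
      by (intro wt_at_top[OF lor c S] tendsto_act_H3[OF lor origin_H3 c S lim])
    then have "\<forall>\<^sub>F i in sequentially. wt (f i) ?c \<ge> R" by (simp add: filterlim_at_top)
    then show ?thesis by eventually_elim (auto simp: wt_linear)
  qed
  have "\<forall>\<^sub>F i in sequentially. dist (act (f i) origin) \<xi> < e / 2"
    using lim e by (intro tendstoD) auto
  moreover note pair[OF three(1,2,4)] pair[OF three(2,3,5)] pair[OF three(1,3,6)]
  ultimately have "\<forall>\<^sub>F i in sequentially. dist (act (f i) origin) \<xi> < e / 2 \<and>
     (\<exists>u\<in>L. \<exists>v\<in>L. u \<noteq> v \<and> wt (f i) u \<ge> R \<and> wt (f i) v \<ge> R)"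
    by eventually_elim (use three in blast)
  then obtain i u v where i: "dist (act (f i) origin) \<xi> < e / 2"
    and uv: "u \<in> L" "v \<in> L" "u \<noteq> v" "wt (f i) u \<ge> R" "wt (f i) v \<ge> R"
    by (auto simp: eventually_sequentially)
  have near: "dist (act (f i) w) \<xi> < e" if w: "w \<in> L" "wt (f i) w \<ge> R" for w
  proof -
    have wb: "w \<in> closed_ball" using w L S2_closed_ball by auto
    have o1: "wt (f i) origin \<ge> 1" using wt_H3_ge[OF lor origin_H3] by (simp add: mink_origin_self)
    have "(dist (act (f i) origin) (act (f i) w))\<^sup>2 \<le> 2 * (- mink origin w) / (wt (f i) origin * wt (f i) w)"
      by (intro dist_act_power2_le lor wb H3_closed_ball origin_H3)
    also have "\<dots> = 2 / (wt (f i) origin * wt (f i) w)" using wb by (simp add: mink_origin closed_ball_def)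
    also have "\<dots> \<le> 2 / (1 * R)" using o1 w(2) R by (intro divide_left_mono mult_mono) (auto intro!: mult_pos_pos)
    also have "\<dots> < (e / 2)\<^sup>2" using e by (simp add: R_def power2_eq_square)
    finally have "dist (act (f i) origin) (act (f i) w) < e / 2"
      by (rule power_less_imp_less_base) (use e in simp)
    then show ?thesis using i dist_triangle_lt[of "act (f i) w" "act (f i) origin" \<xi> e] by (simp add: dist_commute)
  qed
  have "act (f i) u \<noteq> act (f i) v"
    using act_inj[OF G f[of i]] uv L S2_closed_ball by blast
  then show "\<exists>x'\<in>L. x' \<noteq> \<xi> \<and> dist x' \<xi> < e" using near inv[OF f[of i]] uv by metis
qed

text \<open>
  Here \<open>G\<close> preserves a geodesic, and an element of \<open>G\<close> dilates one endpoint exactly as much as it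
  contracts the other.  Elements that move the midpoint \<open>c\<close> towards \<open>a\<close> have inverses that dilate
  \<open>b\<close>, and so contract \<open>a\<close>.
\<close>

lemma two_point_horospherical:
  assumes G: "subgroup G Isom_plus" and ab: "a \<in> S2" "b \<in> S2" "a \<noteq> b"
    and inv: "\<And>g. g \<in> G \<Longrightarrow> act g a \<in> {a, b}" "\<And>g. g \<in> G \<Longrightarrow> act g b \<in> {a, b}"
    and lim: "a \<in> limit_set G"
  shows "horospherical G a"
  unfolding horospherical_def
proof (intro allI impI)
  fix \<epsilon> :: real assume \<epsilon>: "\<epsilon> > 0"
  obtain f :: "nat \<Rightarrow> real^4^4" where f: "\<And>i. f i \<in> G"
    and lim: "(\<lambda>i. act (f i) origin) \<longlonglongrightarrow> a" using lim unfolding limit_set_iff[OF G] by blast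
  have lor: "f i \<in> lorentz" for i by (rule subgroup_lorentz[OF G f])
  define c where "c = (1/2) *\<^sub>R (a + b)"
  define M where "M = - mink a b"
  have cb: "a \<in> closed_ball" "b \<in> closed_ball" using ab S2_closed_ball by auto
  have M: "M > 0" using mink_closed_ball_neg[OF cb ab(3)] by (simp add: M_def)
  have c: "c \<in> H3" unfolding c_def using ab by (rule midpoint_H3)
  have mc: "- mink c v = M / 2" if "v \<in> {a, b}" for v
    using that ab by (auto simp: c_def M_def S2_def mink_linear(1,3) mink_linear(7)[of b a])
  have "(\<lambda>i. act (f i) c) \<longlonglongrightarrow> a" by (rule tendsto_act_H3[OF lor origin_H3 c ab(1) lim])
  moreover from this have "filterlim (\<lambda>i. wt (f i) c) at_top sequentially"
    by (rule wt_at_top[OF lor c ab(1)])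
  ultimately have "filterlim (\<lambda>i. - mink (act (f i) c) b * wt (f i) c) at_top sequentially"
    using M by (intro filterlim_tendsto_pos_mult_at_top[of _ M] tendsto_minus tendsto_mink tendsto_const)
      (auto simp: M_def intro!: tendsto_intros)
  then have "\<forall>\<^sub>F i in sequentially. - mink (act (f i) c) b * wt (f i) c > M / (2 * \<epsilon>)"
    by (simp add: filterlim_at_top_dense)
  then obtain i where i: "- mink (act (f i) c) b * wt (f i) c > M / (2 * \<epsilon>)"
    by (auto simp: eventually_sequentially)
  obtain h where h: "h \<in> G" "h ** f i = mat 1" using subgroup_inverse[OF G f] by blast
  have hl: "h \<in> lorentz" by (rule subgroup_lorentz[OF G h(1)])
  have cc: "c \<in> closed_ball" by (rule H3_closed_ball[OF c])
  have wpos: "wt (f i) c > 0" "wt h a > 0" "wt h b > 0" using wt_pos lor hl cc cb by auto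
  have "mink (act (f i) c) b = (1 / wt (f i) c) * wt h b * mink c (act h b)"
    using mink_act[OF hl act_closed_ball[OF lor cc] cb(2)]
    by (simp add: wt_inverse[OF lor hl h(2) cc] act_inverse[OF lor hl h(2) cc])
  then have "- mink (act (f i) c) b * wt (f i) c = wt h b * - mink c (act h b)"
    using wpos by simp
  then have "wt h b * (M / 2) > M / (2 * \<epsilon>)" using i mc[OF inv(2)[OF h(1)]] by simp
  then have hb: "1 / \<epsilon> < wt h b" using M \<epsilon> by (simp add: field_simps)
  have "act h a \<noteq> act h b" using act_inj[OF G h(1) cb] ab(3) by blast
  then have "- mink (act h a) (act h b) = M"
    unfolding M_def using inv[OF h(1)] mink_linear(7)[of a b] by (metis insertE singletonD)
  then have "wt h a * wt h b * M = M" using mink_act[OF hl cb] by (simp add: M_def)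
  then have "wt h a = 1 / wt h b" using M wpos by (simp add: field_simps)
  also have "\<dots> < \<epsilon>" using hb \<epsilon> wpos by (simp add: field_simps)
  finally show "\<exists>g\<in>G. wt g a < \<epsilon>" using h(1) by blast
qed

section \<open>Cocompactness on the hull of the limit set\<close>

text \<open>
  Translate a point of the hull so that its fourth coordinate is nearly minimal in its orbit;
  this is a Dirichlet domain at \<^const>\<open>origin\<close>, with the factor 2 sparing the proof that the minimum is
  attained.  The condition \<open>1 / 2 \<le> wt h x\<close> is closed and excludes horospherical points, hence all
  points at infinity of the hull.
\<close>

lemma hull_cocompact:
  assumes G: "subgroup G Isom_plus" and horo: "\<And>\<xi>. \<xi> \<in> limit_set G \<Longrightarrow> horospherical G \<xi>"
    and X: "hull3 (limit_set G) \<subseteq> X"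
  shows "compactin (orbit_space G X) (orb G ` (X \<inter> hull3 (limit_set G)))"
proof -
  let ?\<Lambda> = "limit_set G"
  define Q where "Q = {x \<in> convex hull ?\<Lambda>. \<forall>h\<in>G. 1 / 2 \<le> wt h x}"
  have hb: "convex hull ?\<Lambda> \<subseteq> closed_ball" by (rule hull_S2_closed_ball[OF limit_set_S2])
  have "Q = convex hull ?\<Lambda> \<inter> (\<Inter>h\<in>G. {x. 1 / 2 \<le> wt h x})" by (auto simp: Q_def)
  moreover have "closed {x. 1 / 2 \<le> wt h x}" for h
    unfolding wt_def by (intro closed_Collect_le continuous_intros)
  ultimately have cQ: "compact Q"
    using compact_convex_hull[OF compact_limit_set[OF G]] by (auto intro!: compact_Int_closed closed_INT)
  have "x \<notin> S2" if x: "x \<in> Q" for x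
  proof
    assume "x \<in> S2"
    then have "x \<in> ?\<Lambda>" using x S2_convex_hull[OF limit_set_S2] by (auto simp: Q_def)
    then obtain h where "h \<in> G" "wt h x < 1 / 2" using horo[of x] unfolding horospherical_def by (meson half_gt_zero zero_less_one)
    then show False using x by (force simp: Q_def)
  qed
  then have QH: "Q \<subseteq> hull3 ?\<Lambda>" using hb by (auto simp: hull3_def Q_def closed_ball_eq)
  have "orb G x \<in> orb G ` Q" if x: "x \<in> hull3 ?\<Lambda>" for x
  proof -
    have xH: "x \<in> H3" and xc: "x \<in> convex hull ?\<Lambda>" using x by (auto simp: hull3_def)
    have xb: "x \<in> closed_ball" by (rule H3_closed_ball[OF xH])
    let ?I = "Inf ((\<lambda>g. wt g x) ` G)"
    have ge: "sqrt (- mink x x) \<le> wt g x" if "g \<in> G" for g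
      by (rule wt_H3_ge[OF subgroup_lorentz[OF G that] xH])
    have ne: "(\<lambda>g. wt g x) ` G \<noteq> {}" using subgroup_one[OF G] by blast
    have bdd: "bdd_below ((\<lambda>g. wt g x) ` G)" using ge by (auto intro!: bdd_belowI2)
    have "0 < sqrt (- mink x x)" using xH by (simp add: H3_def)
    also have "\<dots> \<le> ?I" using ge ne by (intro cInf_greatest) auto
    finally have I: "?I > 0" .
    then obtain g where g: "g \<in> G" "wt g x < 2 * ?I" using cInf_lessD[OF ne, of "2 * ?I"] by auto
    have gl: "g \<in> lorentz" by (rule subgroup_lorentz[OF G g(1)])
    have "act g x \<in> convex hull ?\<Lambda>"
      using act_limit_set[OF G g(1)] by (intro act_convex_hull gl limit_set_S2 xc) auto
    moreover have "1 / 2 \<le> wt h (act g x)" if h: "h \<in> G" for h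
    proof -
      have "?I \<le> wt (h ** g) x" using subgroup_mult[OF G h g(1)] by (intro cINF_lower[OF bdd])
      also have "\<dots> = wt h (act g x) * wt g x" by (rule act_mult(2)[OF subgroup_lorentz[OF G h] gl xb])
      finally have "wt g x < 2 * (wt h (act g x) * wt g x)" using g(2) by simp
      then show ?thesis using wt_pos[OF gl xb] by simp
    qed
    ultimately have "act g x \<in> Q" by (simp add: Q_def)
    then show ?thesis using orb_act[OF G g(1) xb] by (metis image_eqI)
  qed
  then have "orb G ` (X \<inter> hull3 ?\<Lambda>) = orb G ` Q" using QH X by blast
  then show ?thesis using compactin_orbit_space[OF cQ, of X G] QH X by auto
qed

section \<open>Isolated points up to the group\<close>

text \<open>
  The function \<open>\<phi> v = mink \<xi> v / mink v b\<close> is, up to a constant, the squared distance from \<open>\<xi>\<close> to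
  \<open>v\<close> in a picture where \<open>b\<close> is at infinity.  It is multiplied by a constant under isometries, so being almost
  nearest to \<open>\<xi>\<close> for \<open>\<phi>\<close> survives the renormalization of \<open>(\<xi>, a, b)\<close>; in a
  separated triple it says that \<open>L\<close> has no point near \<open>\<xi>\<close>.
\<close>

lemma isolated_points_finite:
  assumes G: "subgroup G Isom_plus" and L: "L \<subseteq> S2" and inv: "\<And>g u. g \<in> G \<Longrightarrow> u \<in> L \<Longrightarrow> act g u \<in> L"
    and three: "p \<in> L" "q \<in> L" "r \<in> L" "p \<noteq> q" "q \<noteq> r" "p \<noteq> r"
    and tc: "triple_cocompact G L"
  shows "\<exists>\<Lambda>\<^sub>0\<subseteq>L. finite \<Lambda>\<^sub>0 \<and> (\<forall>\<xi>\<in>L. \<not> \<xi> islimpt L \<longrightarrow> (\<exists>g\<in>G. act g \<xi> \<in> \<Lambda>\<^sub>0))"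
proof -
  obtain \<delta> where \<delta>: "\<delta> > 0" and sep: "\<And>a b c. a \<in> L \<Longrightarrow> b \<in> L \<Longrightarrow> c \<in> L \<Longrightarrow> a \<noteq> b \<Longrightarrow> b \<noteq> c \<Longrightarrow> a \<noteq> c \<Longrightarrow>
    \<exists>g\<in>G. separated \<delta> (act g a) (act g b) (act g c)" using tc unfolding triple_cocompact_def by metis
  define \<kappa> where "\<kappa> = sqrt \<delta> / 2"
  have \<kappa>: "\<kappa> > 0" using \<delta> by (simp add: \<kappa>_def)
  (* The separated pair is at distance at least sqrt (2 * \<delta>), and near-minimality gives \<kappa> * dist w ?b \<le> dist ?x w; combine both by the triangle inequality. *)
  define \<rho> where "\<rho> = \<kappa> * sqrt (2 * \<delta>) / (1 + \<kappa>)"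
  have \<rho>: "\<rho> > 0" using \<delta> \<kappa> by (simp add: \<rho>_def)
  define \<Lambda>\<^sub>0 where "\<Lambda>\<^sub>0 = {u \<in> L. \<forall>v\<in>L. v \<noteq> u \<longrightarrow> \<rho> \<le> dist u v}"
  have "uniform_discrete \<Lambda>\<^sub>0"
    unfolding uniform_discrete_def \<Lambda>\<^sub>0_def using \<rho> by (intro exI[of _ \<rho>]) fastforce
  moreover have "bounded \<Lambda>\<^sub>0"
    using L by (intro bounded_subset[OF compact_imp_bounded[OF compact_S2]]) (auto simp: \<Lambda>\<^sub>0_def)
  ultimately have "finite \<Lambda>\<^sub>0" using uniform_discrete_finite_iff by blast
  moreover have "\<exists>g\<in>G. act g \<xi> \<in> \<Lambda>\<^sub>0" if \<xi>: "\<xi> \<in> L" "\<not> \<xi> islimpt L" for \<xi>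
  proof -
    obtain e where e: "e > 0" "\<And>v. v \<in> L \<Longrightarrow> v \<noteq> \<xi> \<Longrightarrow> e \<le> dist v \<xi>"
      using \<xi>(2) unfolding islimpt_approachable by (meson not_less)
    obtain b where b: "b \<in> L" "b \<noteq> \<xi>" using three by metis
    define \<phi> where "\<phi> v = - mink \<xi> v / - mink v b" for v
    have S: "\<xi> \<in> S2" "b \<in> S2" "\<And>v. v \<in> L \<Longrightarrow> v \<in> S2" using \<xi> b L by auto
    have CB: "\<xi> \<in> closed_ball" "b \<in> closed_ball" "\<And>v. v \<in> L \<Longrightarrow> v \<in> closed_ball"
      using S S2_closed_ball by auto
    have \<phi>: "e\<^sup>2 / 4 \<le> \<phi> v" if v: "v \<in> L - {\<xi>, b}" for v
    proof -
      have vb: "- mink v b > 0" using v CB(2) CB(3)[of v] mink_closed_ball_neg[of v b] by auto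
      have "e\<^sup>2 \<le> (dist v \<xi>)\<^sup>2" using e v by (intro power_mono) auto
      also have "\<dots> = 2 * - mink \<xi> v" using dist_power2_S2[of v \<xi>] S v by (simp add: mink_linear(7)[of v \<xi>])
      finally have "e\<^sup>2 / 2 \<le> - mink \<xi> v" by simp
      moreover have "- mink v b \<le> 2" using v CB by (intro mink_closed_ball_ge) auto
      ultimately have "(e\<^sup>2 / 2) / 2 \<le> - mink \<xi> v / - mink v b"
        using mink_closed_ball_nonpos[OF CB(1) CB(3)[of v]] v vb by (intro frac_le) auto
      then show ?thesis by (simp add: \<phi>_def)
    qed
    have ne: "\<phi> ` (L - {\<xi>, b}) \<noteq> {}" using three by blast
    have bdd: "bdd_below (\<phi> ` (L - {\<xi>, b}))" using \<phi> by (intro bdd_belowI2[of _ "e\<^sup>2 / 4"]) auto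
    have "0 < e\<^sup>2 / 4" using e by simp
    also have "\<dots> \<le> Inf (\<phi> ` (L - {\<xi>, b}))" using \<phi> ne by (intro cInf_greatest) auto
    finally have "Inf (\<phi> ` (L - {\<xi>, b})) < 2 * Inf (\<phi> ` (L - {\<xi>, b}))" by simp
    then obtain a where a: "a \<in> L" "a \<noteq> \<xi>" "a \<noteq> b" "\<phi> a < 2 * Inf (\<phi> ` (L - {\<xi>, b}))"
      using cInf_lessD[OF ne] by blast
    have min: "\<phi> a \<le> 2 * \<phi> v" if "v \<in> L - {\<xi>, b}" for v
      using a(4) cINF_lower[OF bdd that] by simp
    obtain g where g: "g \<in> G" "separated \<delta> (act g \<xi>) (act g a) (act g b)"
      using sep[of \<xi> a b] \<xi>(1) a b by auto
    have gl: "g \<in> lorentz" by (rule subgroup_lorentz[OF G g(1)])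
    let ?x = "act g \<xi>" and ?b = "act g b"
    have S': "?x \<in> S2" "?b \<in> S2" using act_S2[OF gl] S by auto
    have \<phi>': "\<phi> v = wt g \<xi> / wt g b * (- mink ?x (act g v) / - mink (act g v) ?b)" if v: "v \<in> L" for v
      using wt_pos[OF gl CB(3)[OF v]] by (simp add: \<phi>_def mink_act[OF gl CB(1) CB(3)[OF v]] mink_act[OF gl CB(3)[OF v] CB(2)])
    have k: "wt g \<xi> / wt g b > 0" using wt_pos[OF gl] CB by simp
    have dxb: "sqrt (2 * \<delta>) \<le> dist ?x ?b"
      using g(2) dist_power2_S2[OF S'] by (intro real_le_lsqrt[THEN order_trans] real_le_lsqrt) (auto simp: separated_def)
    have "\<rho> \<le> dist ?x w" if w: "w \<in> L" "w \<noteq> ?x" for w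
    proof (cases "w = ?b")
      case True
      have "\<rho> = \<kappa> / (1 + \<kappa>) * sqrt (2 * \<delta>)" by (simp add: \<rho>_def)
      also have "\<dots> \<le> 1 * sqrt (2 * \<delta>)" using \<kappa> \<delta> by (intro mult_right_mono) auto
      finally show ?thesis using dxb True by simp
    next
      case False
      obtain h where h: "h \<in> G" "g ** h = mat 1" using subgroup_inverse[OF G g(1)] by blast
      define v where "v = act h w"
      have vL: "v \<in> L" unfolding v_def using inv h w by blast
      have gv: "act g v = w" unfolding v_def
        by (rule act_inverse[OF subgroup_lorentz[OF G h(1)] gl h(2) CB(3)[OF w(1)]])
      have wS: "w \<in> S2" using w S by blast
      have "v \<in> L - {\<xi>, b}" using vL gv False w(2) by auto
      then have "\<phi> a \<le> 2 * \<phi> v" by (rule min)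
      then have "wt g \<xi> / wt g b * (- mink ?x (act g a) / - mink (act g a) ?b)
          \<le> wt g \<xi> / wt g b * (2 * (- mink ?x w / - mink w ?b))"
        unfolding \<phi>'[OF a(1)] \<phi>'[OF vL] gv by (simp only: mult_ac)
      then have "- mink ?x (act g a) / - mink (act g a) ?b \<le> 2 * (- mink ?x w / - mink w ?b)"
        using k by (simp only: mult_le_cancel_left_pos)
      moreover have "\<delta> / 2 \<le> - mink ?x (act g a) / - mink (act g a) ?b"
        using g(2) \<delta> mink_closed_ball_ge[OF act_closed_ball[OF gl CB(3)[OF a(1)]] act_closed_ball[OF gl CB(2)]]
        by (intro frac_le) (auto simp: separated_def)
      moreover have "\<delta> / 2 \<le> s \<Longrightarrow> s \<le> 2 * t \<Longrightarrow> \<delta> / 4 \<le> t" for s t by simp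
      ultimately have "\<delta> / 4 \<le> - mink ?x w / - mink w ?b" by blast
      moreover have "- mink w ?b > 0"
        using mink_closed_ball_neg[OF _ _ False] S2_closed_ball wS S'(2) by simp
      ultimately have "\<delta> / 4 * - mink w ?b \<le> - mink ?x w" by (simp only: pos_le_divide_eq)
      then have "\<delta> / 4 * (dist w ?b)\<^sup>2 \<le> (dist ?x w)\<^sup>2"
        using dist_power2_S2[OF wS S'(2)] dist_power2_S2[OF S'(1) wS]
        by (simp add: algebra_simps)
      moreover have "\<kappa>\<^sup>2 = \<delta> / 4" using \<delta> by (simp add: \<kappa>_def power_divide)
      ultimately have "(\<kappa> * dist w ?b)\<^sup>2 \<le> (dist ?x w)\<^sup>2" by (simp only: power_mult_distrib)
      then have "\<kappa> * dist w ?b \<le> dist ?x w" by (rule power2_le_imp_le) simp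
      moreover have "\<kappa> * sqrt (2 * \<delta>) \<le> \<kappa> * (dist ?x w + dist w ?b)"
        using dxb dist_triangle[of ?x ?b w] \<kappa> by (intro mult_left_mono) auto
      ultimately have "\<kappa> * sqrt (2 * \<delta>) \<le> dist ?x w * (1 + \<kappa>)" by (simp add: algebra_simps)
      then show ?thesis using \<kappa> by (simp add: \<rho>_def pos_divide_le_eq)
    qed
    then have "?x \<in> \<Lambda>\<^sub>0" using inv g(1) \<xi>(1) by (auto simp: \<Lambda>\<^sub>0_def)
    then show ?thesis using g(1) by blast
  qed
  ultimately show ?thesis by (intro exI[of _ \<Lambda>\<^sub>0]) (auto simp: \<Lambda>\<^sub>0_def)
qed

section \<open>The stabilizer of a supporting plane acts cocompactly on triples\<close>

text \<open>
  The centre of the ideal triangle \<open>a, b, c\<close>.  The weights make the sum symmetric and homogeneous of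
  degree one in each of the three null vectors, which makes the centre equivariant.  All weights
  and their sum are nonpositive, so that this is a convex combination.
\<close>

definition centre :: "real ^ 4 \<Rightarrow> real ^ 4 \<Rightarrow> real ^ 4 \<Rightarrow> real ^ 4" where
  "centre a b c = (1 / (mink b c + mink a c + mink a b)) *\<^sub>R
     (mink b c *\<^sub>R a + mink a c *\<^sub>R b + mink a b *\<^sub>R c)"

lemma act_centre:
  assumes A: "A \<in> lorentz" and S: "a \<in> closed_ball" "b \<in> closed_ball" "c \<in> closed_ball" and ne: "a \<noteq> b"
  shows "act A (centre a b c) = centre (act A a) (act A b) (act A c)"
proof -
  let ?a = "act A a" and ?b = "act A b" and ?c = "act A c"
  define k where "k = wt A a * wt A b * wt A c"
  define s where "s = mink b c + mink a c + mink a b"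
  define v where "v = mink ?b ?c *\<^sub>R ?a + mink ?a ?c *\<^sub>R ?b + mink ?a ?b *\<^sub>R ?c"
  have k: "k \<noteq> 0" using wt_pos[OF A S(1)] wt_pos[OF A S(2)] wt_pos[OF A S(3)] by (simp add: k_def)
  have "A *v (mink b c *\<^sub>R a + mink a c *\<^sub>R b + mink a b *\<^sub>R c) = k *\<^sub>R v"
    using A S by (simp add: matrix_vector_right_distrib matrix_vector_mult_scaleR mult_act v_def k_def
        scaleR_add_right mult_ac mink_act[of A a b] mink_act[of A a c] mink_act[of A b c])
  then have e: "A *v centre a b c = (k / s) *\<^sub>R v"
    by (simp add: centre_def s_def matrix_vector_mult_scaleR)
  have v4: "v $ 4 = mink ?b ?c + mink ?a ?c + mink ?a ?b"
    using act_nth4[OF A] S by (simp add: v_def)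
  have "mink b c \<le> 0" "mink a c \<le> 0" "mink a b < 0"
    using S ne by (auto intro: mink_closed_ball_nonpos mink_closed_ball_neg)
  then have "s \<noteq> 0" by (simp add: s_def)
  then show ?thesis
    unfolding act_def[of A "centre a b c"] e using k by (simp add: v4 centre_def flip: v_def)
qed

lemma centre_hull:
  assumes S: "a \<in> S2" "b \<in> S2" "c \<in> S2" "a \<noteq> b" "b \<noteq> c" "a \<noteq> c"
  shows "centre a b c \<in> convex hull {a, b, c}" "centre a b c \<in> H3"
    and "- mink (centre a b c) (centre a b c) =
      6 * (- mink a b) * (- mink b c) * (- mink a c) / (mink b c + mink a c + mink a b)\<^sup>2"
proof -
  define s where "s = mink b c + mink a c + mink a b"
  have neg: "mink b c < 0" "mink a c < 0" "mink a b < 0"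
    using S by (auto intro!: mink_closed_ball_neg S2_closed_ball)
  then have s: "s < 0" by (simp add: s_def)
  have eq: "centre a b c = (mink b c / s) *\<^sub>R a + (mink a c / s) *\<^sub>R b + (mink a b / s) *\<^sub>R c"
    by (simp add: centre_def s_def scaleR_add_right)
  have "mink b c / s + mink a c / s + mink a b / s = 1"
    using s by (simp add: s_def add_divide_distrib[symmetric])
  then show hull: "centre a b c \<in> convex hull {a, b, c}"
    unfolding convex_hull_3 eq using neg s
    by (intro CollectI exI[of _ "mink b c / s"] exI[of _ "mink a c / s"] exI[of _ "mink a b / s"])
      (auto intro: divide_nonpos_nonpos)
  define t where "t = mink b c *\<^sub>R a + mink a c *\<^sub>R b + mink a b *\<^sub>R c"
  have self: "mink a a = 0" "mink b b = 0" "mink c c = 0" using S by (auto simp: S2_def)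
  have "mink t t = 6 * mink a b * mink b c * mink a c"
    by (simp add: t_def mink_linear(1-4) self mink_linear(7)[of b a] mink_linear(7)[of c a] mink_linear(7)[of c b])
  moreover have "centre a b c = (1 / s) *\<^sub>R t" by (simp add: centre_def s_def t_def)
  ultimately have m: "mink (centre a b c) (centre a b c) = 6 * mink a b * mink b c * mink a c / s\<^sup>2"
    by (simp add: mink_linear(1,2) power2_eq_square)
  then show "- mink (centre a b c) (centre a b c) =
      6 * (- mink a b) * (- mink b c) * (- mink a c) / (mink b c + mink a c + mink a b)\<^sup>2"
    by (simp add: s_def)
  have "mink (centre a b c) (centre a b c) < 0"
    unfolding m using neg s by (intro divide_neg_pos) (auto simp: mult_less_0_iff zero_less_mult_iff)
  moreover have "centre a b c \<in> closed_ball"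
    using hull hull_S2_closed_ball[of "{a, b, c}"] S by auto
  ultimately show "centre a b c \<in> H3" by (simp add: H3_def closed_ball_def)
qed

text \<open>
  With \<open>A = - mink b c\<close> and so on, the hypothesis reads \<open>\<eta> * (A + B + C)\<^sup>2 \<le> 6 * A * B * C\<close>, and
  \<open>(A + B + C)\<^sup>2\<close> is at least four times the product of any two of the three numbers.
\<close>

lemma thick_centre_separated:
  assumes S: "a \<in> S2" "b \<in> S2" "c \<in> S2" "a \<noteq> b" "b \<noteq> c" "a \<noteq> c"
    and \<eta>: "\<eta> > 0" "\<eta> \<le> - mink (centre a b c) (centre a b c)"
  shows "separated (2 * \<eta> / 3) a b c"
proof -
  define A B C where "A = - mink b c" and "B = - mink a c" and "C = - mink a b"
  have pos: "A > 0" "B > 0" "C > 0"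
    using S by (auto simp: A_def B_def C_def intro!: mink_closed_ball_neg S2_closed_ball)
  have sq: "(mink b c + mink a c + mink a b)\<^sup>2 = (A + B + C)\<^sup>2"
    by (simp add: A_def B_def C_def power2_eq_square algebra_simps)
  have "\<eta> \<le> 6 * C * A * B / (A + B + C)\<^sup>2"
    using \<eta>(2) unfolding centre_hull(3)[OF S] sq by (simp add: A_def B_def C_def)
  then have le: "\<eta> * (A + B + C)\<^sup>2 \<le> 6 * C * A * B"
    using pos by (subst (asm) pos_le_divide_eq) auto
  have key: "2 * \<eta> / 3 \<le> x" if xyz: "x > 0" "y > 0" "z > 0" "\<eta> * (x + y + z)\<^sup>2 \<le> 6 * (x * (y * z))" for x y z
  proof -
    have "4 * (y * z) \<le> (y + z)\<^sup>2" using zero_le_power2[of "y - z"] by (simp add: power2_eq_square algebra_simps)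
    also have "\<dots> \<le> (x + y + z)\<^sup>2" using xyz by (intro power_mono) auto
    finally have "\<eta> * (4 * (y * z)) \<le> 6 * (x * (y * z))" using \<eta>(1) xyz(4)
      by (meson mult_left_mono less_imp_le order_trans)
    then have "(4 * \<eta>) * (y * z) \<le> (6 * x) * (y * z)" by (simp add: mult_ac)
    then show ?thesis using xyz by (simp add: mult_le_cancel_right)
  qed
  have "2 * \<eta> / 3 \<le> A" "2 * \<eta> / 3 \<le> B" "2 * \<eta> / 3 \<le> C"
    using le pos by (intro key[of A B C] key[of B A C] key[of C A B]; simp add: add_ac mult_ac)+
  then show ?thesis by (simp add: separated_def A_def B_def C_def)
qed

lemma mink_mult_act:
  "A \<in> lorentz \<Longrightarrow> x \<in> closed_ball \<Longrightarrow> mink (A *v n) (act A x) = mink n x / wt A x"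
  using mink_lorentz[of A n x] wt_pos[of A x] by (simp add: mult_act mink_linear(2) field_simps)

lemma wt_bounded_S2:
  obtains M where "M > 0" "\<And>u. u \<in> S2 \<Longrightarrow> wt A u \<le> M"
proof -
  have "continuous_on S2 (wt A)"
    unfolding wt_def by (intro continuous_intros)
  then have "bounded (wt A ` S2)"
    using compact_S2 compact_continuous_image compact_imp_bounded by blast
  then obtain M where "M > 0" "\<And>u. u \<in> S2 \<Longrightarrow> norm (wt A u) \<le> M"
    unfolding bounded_pos by auto
  then show thesis using that by force
qed

lemma separated_act:
  assumes h: "h \<in> lorentz" and M: "\<And>u. u \<in> S2 \<Longrightarrow> wt h u \<le> M" and \<delta>: "\<delta> > 0"
    and S: "a \<in> S2" "b \<in> S2" "c \<in> S2" and sep: "separated \<delta> a b c"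
  shows "separated (\<delta> / M\<^sup>2) (act h a) (act h b) (act h c)"
proof -
  have *: "\<delta> / M\<^sup>2 \<le> - mink (act h u) (act h v)" if uv: "u \<in> S2" "v \<in> S2" "\<delta> \<le> - mink u v" for u v
  proof -
    have cb: "u \<in> closed_ball" "v \<in> closed_ball" using uv S2_closed_ball by auto
    have pos: "wt h u > 0" "wt h v > 0" using wt_pos[OF h] cb by auto
    have "\<delta> / M\<^sup>2 \<le> - mink u v / (wt h u * wt h v)"
      using pos \<delta> uv M[OF uv(1)] M[OF uv(2)] unfolding power2_eq_square
      by (intro frac_le mult_mono) auto
    also have "\<dots> = - mink (act h u) (act h v)"
      using pos by (subst mink_act[OF h cb]) simp
    finally show ?thesis .
  qed
  show ?thesis using sep S by (auto simp: separated_def intro!: *)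
qed

lemma separated_mono: "separated \<delta> a b c \<Longrightarrow> \<delta>' \<le> \<delta> \<Longrightarrow> separated \<delta>' a b c"
  by (auto simp: separated_def)

text \<open>
  A triple on the circle is first separated by an element \<open>g\<close> of the whole group \<open>\<Gamma>\<close>.
  The normal \<open>g *v n\<close> then belongs to the finite set \<open>N\<close>.  For each \<open>m \<in> N\<close> that
  occurs, one fixed element of \<open>\<Gamma>\<close> takes \<open>m\<close> back to \<open>n\<close>; composing \<open>g\<close> with it yields an element
  that fixes \<open>n\<close>, at the cost of a factor that depends only on \<open>m\<close>.
\<close>

lemma stabilizer_triple_cocompact:
  fixes \<Gamma> n
  defines "\<Lambda> \<equiv> limit_set \<Gamma>"
  assumes \<Gamma>: "subgroup \<Gamma> Isom_plus"
    and \<eta>: "\<eta> > 0" "\<And>x. x \<in> hull3 \<Lambda> \<Longrightarrow> \<exists>g\<in>\<Gamma>. \<eta> \<le> - mink (act g x) (act g x)"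
    and n: "mink n n = 1" "\<And>v. v \<in> \<Lambda> \<Longrightarrow> 0 \<le> mink n v"
  shows "triple_cocompact {g \<in> \<Gamma>. g *v n = n} (circle n \<inter> \<Lambda>)"
proof -
  define \<delta> where "\<delta> = 2 * \<eta> / 3"
  have \<delta>: "\<delta> > 0" using \<eta> by (simp add: \<delta>_def)
  have lor: "g \<in> lorentz" if "g \<in> \<Gamma>" for g by (rule subgroup_lorentz[OF \<Gamma> that])
  have \<Lambda>S: "\<Lambda> \<subseteq> S2" unfolding \<Lambda>_def by (rule limit_set_S2)
  have \<Lambda>cb: "\<Lambda> \<subseteq> closed_ball" using \<Lambda>S S2_closed_ball by auto
  have act\<Lambda>: "act g v \<in> \<Lambda>" if "g \<in> \<Gamma>" "v \<in> \<Lambda>" for g v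
    using act_limit_set[OF \<Gamma>] that by (simp add: \<Lambda>_def)
  define N where "N = {m. mink m m = 1 \<and> (\<forall>v\<in>\<Lambda>. 0 \<le> mink m v) \<and>
    (\<exists>a\<in>\<Lambda>. \<exists>b\<in>\<Lambda>. \<exists>c\<in>\<Lambda>. separated \<delta> a b c \<and> mink m a = 0 \<and> mink m b = 0 \<and> mink m c = 0)}"
  have finN: "finite N" unfolding N_def
    using compact_limit_set[OF \<Gamma>] by (intro finite_thick_supports \<Lambda>S \<delta>) (simp add: \<Lambda>_def)
  define returns where "returns m d \<longleftrightarrow> d > 0 \<and> (\<forall>g\<in>\<Gamma>. g *v n = m \<longrightarrow>
      (\<forall>a\<in>\<Lambda>. \<forall>b\<in>\<Lambda>. \<forall>c\<in>\<Lambda>. separated \<delta> (act g a) (act g b) (act g c) \<longrightarrow>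
        (\<exists>h\<in>{g \<in> \<Gamma>. g *v n = n}. separated d (act h a) (act h b) (act h c))))" for m d
  have "\<exists>d. returns m d" for m
  proof (cases "\<exists>k\<in>\<Gamma>. k *v n = m")
    case True
    then obtain k where k: "k \<in> \<Gamma>" "k *v n = m" by blast
    obtain h where h: "h \<in> \<Gamma>" "h ** k = mat 1" using subgroup_inverse[OF \<Gamma> k(1)] by blast
    have hm: "h *v m = n" using h(2) k(2) by (metis matrix_vector_mul_assoc matrix_vector_mul_lid)
    obtain M where M: "M > 0" "\<And>u. u \<in> S2 \<Longrightarrow> wt h u \<le> M" using wt_bounded_S2[of h] by blast
    show ?thesis unfolding returns_def
    proof (intro exI[of _ "\<delta> / M\<^sup>2"] conjI ballI impI)
      fix g a b c assume g: "g \<in> \<Gamma>" "g *v n = m" and abc: "a \<in> \<Lambda>" "b \<in> \<Lambda>" "c \<in> \<Lambda>"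
        and sep: "separated \<delta> (act g a) (act g b) (act g c)"
      have sep': "separated (\<delta> / M\<^sup>2) (act h (act g a)) (act h (act g b)) (act h (act g c))"
        using act\<Lambda>[OF g(1)] abc \<Lambda>S by (intro separated_act lor h M \<delta> sep) auto
      have "act (h ** g) u = act h (act g u)" if "u \<in> \<Lambda>" for u
        using act_mult(1)[OF lor[OF h(1)] lor[OF g(1)]] that \<Lambda>cb by auto
      with sep' abc have "separated (\<delta> / M\<^sup>2) (act (h ** g) a) (act (h ** g) b) (act (h ** g) c)" by simp
      moreover have "h ** g \<in> {g \<in> \<Gamma>. g *v n = n}"
        using subgroup_mult[OF \<Gamma> h(1) g(1)] hm g(2) by (simp flip: matrix_vector_mul_assoc)
      ultimately show "\<exists>h\<in>{g \<in> \<Gamma>. g *v n = n}. separated (\<delta> / M\<^sup>2) (act h a) (act h b) (act h c)"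
        by blast
    qed (use M \<delta> in simp)
  qed (auto simp: returns_def intro!: exI[of _ 1])
  then obtain d where d: "\<And>m. returns m (d m)" by metis
  define D where "D = Min (insert 1 (d ` N))"
  have D: "D > 0" "\<And>m. m \<in> N \<Longrightarrow> D \<le> d m" using finN d by (auto simp: D_def returns_def)
  show ?thesis unfolding triple_cocompact_def
  proof (intro exI[of _ D] conjI ballI impI D(1))
    fix a b c assume abc: "a \<in> circle n \<inter> \<Lambda>" "b \<in> circle n \<inter> \<Lambda>" "c \<in> circle n \<inter> \<Lambda>"
      and ne: "a \<noteq> b" "b \<noteq> c" "a \<noteq> c"
    have S: "a \<in> S2" "b \<in> S2" "c \<in> S2" using abc \<Lambda>S by auto
    have cb: "a \<in> closed_ball" "b \<in> closed_ball" "c \<in> closed_ball" using S S2_closed_ball by auto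
    have "centre a b c \<in> hull3 \<Lambda>"
      using centre_hull(1,2)[OF S ne] hull_mono[of "{a, b, c}" \<Lambda> convex] abc by (auto simp: hull3_def)
    then obtain g where g: "g \<in> \<Gamma>" "\<eta> \<le> - mink (act g (centre a b c)) (act g (centre a b c))"
      using \<eta>(2) by blast
    have gl: "g \<in> lorentz" by (rule lor[OF g(1)])
    have gne: "act g a \<noteq> act g b" "act g b \<noteq> act g c" "act g a \<noteq> act g c"
      using act_inj[OF \<Gamma> g(1)] cb ne by blast+
    have sep: "separated \<delta> (act g a) (act g b) (act g c)"
      using g(2) unfolding \<delta>_def act_centre[OF gl cb ne(1)]
      by (intro thick_centre_separated act_S2 gl S gne \<eta>(1))
    have "g *v n \<in> N"
      unfolding N_def
    proof (intro CollectI conjI ballI)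
      show "mink (g *v n) (g *v n) = 1" using n(1) by (simp add: mink_lorentz[OF gl])
    next
      fix v assume v: "v \<in> \<Lambda>"
      obtain h where h: "h \<in> \<Gamma>" "g ** h = mat 1" using subgroup_inverse[OF \<Gamma> g(1)] by blast
      have u: "act h v \<in> \<Lambda>" by (rule act\<Lambda>[OF h(1) v])
      have ucb: "act h v \<in> closed_ball" using u \<Lambda>cb by blast
      have "mink (g *v n) v = mink n (act h v) / wt g (act h v)"
        using mink_mult_act[OF gl ucb, of n]
        by (simp add: act_inverse[OF lor[OF h(1)] gl h(2) subsetD[OF \<Lambda>cb v]])
      also have "\<dots> \<ge> 0" using n(2)[OF u] wt_pos[OF gl ucb] by simp
      finally show "0 \<le> mink (g *v n) v" .
    next
      have "mink (g *v n) (act g u) = 0" if "u \<in> circle n" "u \<in> closed_ball" for u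
        using mink_mult_act[OF gl that(2), of n] that(1) by (simp add: circle_def)
      then show "\<exists>a\<in>\<Lambda>. \<exists>b\<in>\<Lambda>. \<exists>c\<in>\<Lambda>. separated \<delta> a b c \<and>
          mink (g *v n) a = 0 \<and> mink (g *v n) b = 0 \<and> mink (g *v n) c = 0"
        using sep abc cb act\<Lambda>[OF g(1)] by (metis IntE)
    qed
    then have "D \<le> d (g *v n)" by (rule D(2))
    moreover have "\<exists>h\<in>{g \<in> \<Gamma>. g *v n = n}. separated (d (g *v n)) (act h a) (act h b) (act h c)"
      using d[of "g *v n"] g(1) abc sep unfolding returns_def by blast
    ultimately show "\<exists>h\<in>{g \<in> \<Gamma>. g *v n = n}. separated D (act h a) (act h b) (act h c)"
      using separated_mono by blast
  qed
qed

lemma triple_cocompact_mono: "triple_cocompact G L \<Longrightarrow> G \<subseteq> H \<Longrightarrow> triple_cocompact H L"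
  unfolding triple_cocompact_def by (meson subset_iff)

section \<open>Stabilizers of oriented circles and faces of the hull\<close>

lemma circle_S2: "circle n \<subseteq> S2"
  by (auto simp: circle_def)

lemma circle_uminus: "circle (- n) = circle n"
  by (auto simp: circle_def mink_def)

lemma circle_stab_act: "g \<in> circle_stab \<Gamma> n \<Longrightarrow> u \<in> circle n \<Longrightarrow> act g u \<in> circle n"
  by (auto simp: circle_stab_def)

lemma image_act_inverse:
  assumes "g \<in> lorentz" "h \<in> lorentz" "h ** g = mat 1" "X \<subseteq> S2" "act g ` X = X"
  shows "act h ` X = X"
proof -
  have "act h ` X = act h ` act g ` X" using assms(5) by simp
  also have "\<dots> = (\<lambda>x. x) ` X"
    unfolding image_image using assms(4) S2_closed_ball
    by (intro image_cong refl act_inverse[OF assms(1-3)]) auto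
  finally show ?thesis by simp
qed

lemma subgroup_circle_stab:
  assumes \<Gamma>: "subgroup \<Gamma> Isom_plus" shows "subgroup (circle_stab \<Gamma> n) Isom_plus"
proof
  have lor: "g \<in> lorentz" if "g \<in> \<Gamma>" for g by (rule subgroup_lorentz[OF \<Gamma> that])
  have S: "circle n \<subseteq> S2" "disc n \<subseteq> S2" by (auto simp: circle_def disc_def)
  show "circle_stab \<Gamma> n \<subseteq> carrier Isom_plus"
    using subgroup.subset[OF \<Gamma>] by (auto simp: circle_stab_def)
  show "\<one>\<^bsub>Isom_plus\<^esub> \<in> circle_stab \<Gamma> n"
  proof -
    have "act (mat 1) ` X = X" if "X \<subseteq> S2" for X
      using that S2_closed_ball by (force simp: image_iff act_one)
    then show ?thesis using S subgroup_one[OF \<Gamma>] by (simp add: circle_stab_def Isom_plus_def)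
  qed
  fix g assume g: "g \<in> circle_stab \<Gamma> n"
  then have g\<Gamma>: "g \<in> \<Gamma>" by (simp add: circle_stab_def)
  show "inv\<^bsub>Isom_plus\<^esub> g \<in> circle_stab \<Gamma> n"
  proof -
    have c: "g \<in> carrier Isom_plus" using g\<Gamma> subgroup.subset[OF \<Gamma>] by blast
    have i: "inv\<^bsub>Isom_plus\<^esub> g \<in> \<Gamma>" by (rule subgroup.m_inv_closed[OF \<Gamma> g\<Gamma>])
    moreover have "inv\<^bsub>Isom_plus\<^esub> g ** g = mat 1"
      using group.l_inv[OF group_Isom_plus c] by (simp add: Isom_plus_def)
    ultimately show ?thesis
      using g S image_act_inverse[OF lor[OF g\<Gamma>] lor[OF i]] by (simp add: circle_stab_def)
  qed
  fix h assume h: "h \<in> circle_stab \<Gamma> n"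
  then have h\<Gamma>: "h \<in> \<Gamma>" by (simp add: circle_stab_def)
  have "act (g ** h) ` X = act g ` act h ` X" if "X \<subseteq> S2" for X
    unfolding image_image using that S2_closed_ball
    by (intro image_cong refl act_mult(1)[OF lor[OF g\<Gamma>] lor[OF h\<Gamma>]]) auto
  then show "g \<otimes>\<^bsub>Isom_plus\<^esub> h \<in> circle_stab \<Gamma> n"
    using g h S subgroup_mult[OF \<Gamma> g\<Gamma> h\<Gamma>] by (simp add: circle_stab_def Isom_plus_def)
qed

lemma fixes_normal_circle_stab:
  assumes \<Gamma>: "subgroup \<Gamma> Isom_plus" and g: "g \<in> \<Gamma>" "g *v n = n"
  shows "g \<in> circle_stab \<Gamma> n"
proof -
  obtain h where h: "h \<in> \<Gamma>" "h ** g = mat 1" "g ** h = mat 1" using subgroup_inverse[OF \<Gamma> g(1)] by blast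
  have lor: "g \<in> lorentz" "h \<in> lorentz" using subgroup_lorentz[OF \<Gamma>] g h by auto
  have hn: "h *v n = n" using h(2) g(2) by (metis matrix_vector_mul_assoc matrix_vector_mul_lid)
  have m: "mink n (act k u) = mink n u / wt k u" "act k u \<in> S2" "wt k u > 0"
    if "k \<in> {g, h}" "u \<in> S2" for k u
    using that lor g(2) hn mink_mult_act[of k u n] wt_pos[of k u] act_S2[of k u] S2_closed_ball[of u] by auto
  have img: "act g ` X = X" if X: "X \<subseteq> S2" "\<And>k u. k \<in> {g, h} \<Longrightarrow> u \<in> X \<Longrightarrow> act k u \<in> X" for X
  proof (intro equalityI subsetI)
    fix u assume u: "u \<in> X"
    then have "u = act g (act h u)" using act_inverse[OF lor(2,1) h(3)] X(1) S2_closed_ball by auto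
    then show "u \<in> act g ` X" using X(2)[of h u] u by blast
  qed (use X(2) in auto)
  have "act k u \<in> circle n" if "k \<in> {g, h}" "u \<in> circle n" for k u
    using m[of k u] that by (auto simp: circle_def)
  then have "act g ` circle n = circle n" by (rule img[OF circle_S2])
  moreover have "act k u \<in> disc n" if "k \<in> {g, h}" "u \<in> disc n" for k u
    using m[of k u] that by (auto simp: disc_def)
  then have "act g ` disc n = disc n" by (rule img[rotated]) (auto simp: disc_def)
  ultimately show ?thesis using g(1) by (simp add: circle_stab_def)
qed

text \<open>
  A point of \<open>L\<close> is the end of a segment whose other points lie in \<^const>\<open>hull3\<close>.
\<close>

lemma half_space_limit_set:
  assumes L: "L \<subseteq> S2" and c: "c \<in> hull3 L" and K: "\<And>x. x \<in> hull3 L \<Longrightarrow> 0 \<le> mink n x" and u: "u \<in> L"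
  shows "0 \<le> mink n u"
proof (rule ccontr)
  assume "\<not> 0 \<le> mink n u"
  then have \<beta>: "mink n u < 0" by simp
  have \<alpha>: "0 \<le> mink n c" by (rule K[OF c])
  (* Far enough towards u for the value of mink n to be half of mink n u. *)
  define t where "t = - mink n u / (2 * (mink n c - mink n u))"
  have t: "0 < t" "t \<le> 1" using \<alpha> \<beta> by (auto simp: t_def field_simps)
  have cH: "c \<in> H3" "c \<in> convex hull L" using c by (auto simp: hull3_def)
  have "t *\<^sub>R c + (1 - t) *\<^sub>R u \<in> H3"
    using t u L by (intro open_segment_H3 cH S2_closed_ball) auto
  moreover have "t *\<^sub>R c + (1 - t) *\<^sub>R u \<in> convex hull L"
    using t by (intro convexD[OF convex_convex_hull] cH hull_inc u) auto
  ultimately have "0 \<le> mink n (t *\<^sub>R c + (1 - t) *\<^sub>R u)" by (intro K) (simp add: hull3_def)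
  also have "\<dots> = t * (mink n c - mink n u) + mink n u" by (simp only: mink_linear(2,4)) (simp add: algebra_simps)
  also have "\<dots> = mink n u / 2" using \<alpha> \<beta> by (simp add: t_def field_simps)
  finally show False using \<beta> by simp
qed

text \<open>
  The face of a convex hull cut out by a supporting hyperplane is spanned by the points of \<open>L\<close> on
  that hyperplane.  The hull is contained in the union of the open half-space and of this face, as
  that union is convex.
\<close>

lemma supporting_plane_hull:
  assumes L: "\<And>v. v \<in> L \<Longrightarrow> 0 \<le> mink n v" and x: "x \<in> convex hull L" "mink n x = 0"
  shows "x \<in> convex hull {v \<in> L. mink n v = 0}"
proof -
  let ?F = "convex hull {v \<in> L. mink n v = 0}"
  let ?C = "{y. mink n y > 0} \<union> ?F"
  have F: "mink n y = 0" if "y \<in> ?F" for y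
  proof -
    have "convex {y. mink n y = 0}" by (rule convexI) (simp add: mink_linear(2,4))
    then have "?F \<subseteq> {y. mink n y = 0}" by (intro hull_minimal) auto
    then show ?thesis using that by auto
  qed
  have "convex ?C"
  proof (rule convexI)
    fix x y and u v :: real assume xy: "x \<in> ?C" "y \<in> ?C" and uv: "0 \<le> u" "0 \<le> v" "u + v = 1"
    show "u *\<^sub>R x + v *\<^sub>R y \<in> ?C"
    proof (cases "u = 0 \<or> v = 0 \<or> (x \<in> ?F \<and> y \<in> ?F)")
      case True
      then show ?thesis using xy uv convexD[OF convex_convex_hull[of "{v \<in> L. mink n v = 0}"], of x y u v] by auto
    next
      case False
      then have "u > 0" "v > 0" using uv by auto
      moreover have "mink n x > 0 \<and> mink n y \<ge> 0 \<or> mink n x \<ge> 0 \<and> mink n y > 0"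
        using xy False F by auto
      ultimately have "0 < u * mink n x + v * mink n y"
        by (auto intro: add_pos_nonneg add_nonneg_pos)
      then show ?thesis by (simp add: mink_linear(2,4))
    qed
  qed
  moreover have "L \<subseteq> ?C"
  proof
    fix v assume "v \<in> L"
    then show "v \<in> ?C" using L[of v] by (cases "mink n v = 0") (auto intro: hull_inc)
  qed
  ultimately have "convex hull L \<subseteq> ?C" by (intro hull_minimal)
  then show ?thesis using x by auto
qed

lemma hull3_two_points:
  assumes L: "L \<subseteq> S2" and ne: "hull3 L \<noteq> {}"
  obtains a b where "a \<in> L" "b \<in> L" "a \<noteq> b"
proof -
  obtain x where x: "x \<in> H3" "x \<in> convex hull L" using ne by (auto simp: hull3_def)
  then obtain a where a: "a \<in> L" by (metis convex_hull_empty ex_in_conv)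
  have "L \<noteq> {a}" using x L by (auto simp: H3_def S2_def)
  then show thesis using a that by blast
qed

text \<open>
  The midpoint of two points of the circle has its orbit in the plane bounded by the circle, and
  any orbit in \<^const>\<open>H3\<close> detects the limit set.
\<close>

lemma limit_set_in_circle:
  assumes G: "subgroup G Isom_plus" and inv: "\<And>g u. g \<in> G \<Longrightarrow> u \<in> circle n \<Longrightarrow> act g u \<in> circle n"
    and uv: "u \<in> circle n" "v \<in> circle n" "u \<noteq> v"
  shows "limit_set G \<subseteq> circle n"
proof
  fix \<xi> assume "\<xi> \<in> limit_set G"
  then obtain f :: "nat \<Rightarrow> real^4^4" where S: "\<xi> \<in> S2" and f: "\<And>i. f i \<in> G"
    and lim: "(\<lambda>i. act (f i) origin) \<longlonglongrightarrow> \<xi>" unfolding limit_set_iff[OF G] by blast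
  have lor: "f i \<in> lorentz" for i by (rule subgroup_lorentz[OF G f])
  let ?c = "(1/2) *\<^sub>R (u + v)"
  have uvS: "u \<in> S2" "v \<in> S2" using uv circle_S2 by auto
  have c: "?c \<in> H3" by (rule midpoint_H3[OF uvS uv(3)])
  have lim: "(\<lambda>i. act (f i) ?c) \<longlonglongrightarrow> \<xi>" by (rule tendsto_act_H3[OF lor origin_H3 c S lim])
  have "mink n (act (f i) ?c) = 0" for i
  proof -
    have "mink n (act (f i) u) = 0" "mink n (act (f i) v) = 0"
      using inv[OF f] uv by (auto simp: circle_def)
    then have "mink n (f i *v u) = 0" "mink n (f i *v v) = 0"
      using uvS S2_closed_ball by (simp_all add: mult_act[OF lor] mink_linear(2))
    then show ?thesis
      by (simp add: act_def mink_linear(2,4) matrix_vector_right_distrib matrix_vector_mult_scaleR)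
  qed
  moreover have "(\<lambda>i. mink n (act (f i) ?c)) \<longlonglongrightarrow> mink n \<xi>" by (intro tendsto_mink tendsto_const lim)
  ultimately have "mink n \<xi> = 0" by (simp add: LIMSEQ_const_iff)
  then show "\<xi> \<in> circle n" using S by (simp add: circle_def)
qed

theorem theorem5p1:
  fixes \<Gamma> :: "(real ^ 4 ^ 4) set" and n :: "real ^ 4"
  assumes "kleinian \<Gamma>" and "torsion_free \<Gamma>" and "convex_cocompact_on H3 \<Gamma>"
    and "supporting n (hull3 (limit_set \<Gamma>))"
  shows "convex_cocompact_fuchsian n (circle_stab \<Gamma> n) \<and>
    (\<exists>\<Lambda>\<^sub>0. finite \<Lambda>\<^sub>0 \<and> \<Lambda>\<^sub>0 \<subseteq> S2 \<and>
      circle n \<inter> limit_set \<Gamma> =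
        limit_set (circle_stab \<Gamma> n) \<union> (\<Union>g\<in>circle_stab \<Gamma> n. act g ` \<Lambda>\<^sub>0))"
proof -
  define \<Lambda> where "\<Lambda> = limit_set \<Gamma>"
  define L where "L = circle n \<inter> \<Lambda>"
  define G where "G = circle_stab \<Gamma> n"
  have \<Gamma>: "subgroup \<Gamma> Isom_plus" and disc: "discrete \<Gamma>" using assms(1) by (auto simp: kleinian_def)
  have G: "subgroup G Isom_plus" unfolding G_def by (rule subgroup_circle_stab[OF \<Gamma>])
  have G\<Gamma>: "G \<subseteq> \<Gamma>" by (auto simp: G_def circle_stab_def)
  have lor: "g \<in> lorentz" if "g \<in> G" for g by (rule subgroup_lorentz[OF G that])
  have \<Lambda>S: "\<Lambda> \<subseteq> S2" unfolding \<Lambda>_def by (rule limit_set_S2)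
  have LS: "L \<subseteq> S2" using \<Lambda>S by (auto simp: L_def)
  have Lcb: "u \<in> closed_ball" if "u \<in> L" for u using that LS S2_closed_ball by blast
  have inv: "act g u \<in> L" if "g \<in> G" "u \<in> L" for g u
    using that G\<Gamma> act_limit_set[OF \<Gamma>] circle_stab_act by (auto simp: L_def G_def \<Lambda>_def)
  have K: "hull3 \<Lambda> \<subseteq> H3" by (auto simp: hull3_def)
  have par: "\<not> parabolic g" if "g \<in> \<Gamma>" for g using assms(3) that by (auto simp: convex_cocompact_on_def)
  have "compactin (orbit_space \<Gamma> H3) (orb \<Gamma> ` hull3 \<Lambda>)"
    using assms(3) K by (simp add: convex_cocompact_on_def \<Lambda>_def Int_absorb1)
  then obtain \<eta> where \<eta>: "\<eta> > 0" "\<And>x. x \<in> hull3 \<Lambda> \<Longrightarrow> \<exists>g\<in>\<Gamma>. \<eta> \<le> - mink (act g x) (act g x)"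
    using compactin_orbit_space_thick[OF \<Gamma> K] by blast
  obtain x0 where n1: "mink n n = 1" and x0: "mink n x0 = 0" "x0 \<in> hull3 \<Lambda>"
    and side: "hull3 \<Lambda> \<subseteq> {x \<in> H3. 0 \<le> mink n x} \<or> hull3 \<Lambda> \<subseteq> {x \<in> H3. mink n x \<le> 0}"
    using assms(4) by (auto simp: supporting_def plane_def \<Lambda>_def)
  (* The normal that points to the side of the hull.  The stabilizer of the oriented circle is the same for n and - n. *)
  obtain m where m: "m = n \<or> m = - n" "\<And>x. x \<in> hull3 \<Lambda> \<Longrightarrow> 0 \<le> mink m x"
    using side by (force simp: mink_def)
  have uminus: "mink (- n) x = - mink n x" for x by (simp add: mink_def)
  have m1: "mink m m = 1" and m0: "mink m x = 0 \<longleftrightarrow> mink n x = 0" for x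
    using m(1) n1 by (auto simp: mink_def)
  have circ: "circle m = circle n" using m(1) circle_uminus by auto
  have m\<Lambda>: "0 \<le> mink m v" if "v \<in> \<Lambda>" for v
    using half_space_limit_set[OF \<Lambda>S x0(2) m(2) that] by simp
  have "triple_cocompact {g \<in> \<Gamma>. g *v m = m} L"
    using stabilizer_triple_cocompact[OF \<Gamma> \<eta>[unfolded \<Lambda>_def] m1 m\<Lambda>[unfolded \<Lambda>_def]]
    by (simp add: circ L_def \<Lambda>_def)
  moreover have "{g \<in> \<Gamma>. g *v m = m} \<subseteq> G"
  proof
    fix g assume g: "g \<in> {g \<in> \<Gamma>. g *v m = m}"
    have "g *v (- n) = - (g *v n)"
      using matrix_vector_mult_scaleR[of g "-1" n] by simp
    then have "g *v n = n" using g m(1) by auto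
    then show "g \<in> G" unfolding G_def using g by (intro fixes_normal_circle_stab[OF \<Gamma>]) auto
  qed
  ultimately have tc: "triple_cocompact G L" by (rule triple_cocompact_mono)

  obtain p q where pq: "p \<in> L" "q \<in> L" "p \<noteq> q"
  proof -
    have "x0 \<in> convex hull {v \<in> \<Lambda>. mink m v = 0}"
      using x0 by (intro supporting_plane_hull m\<Lambda>) (auto simp: m0 hull3_def)
    moreover have "{v \<in> \<Lambda>. mink m v = 0} = L" using \<Lambda>S by (auto simp: L_def circle_def m0)
    ultimately have "hull3 L \<noteq> {}" using x0(2) by (auto simp: hull3_def)
    then show thesis using hull3_two_points[OF LS] that by blast
  qed
  have "limit_set G \<subseteq> circle n"
    using pq circle_stab_act by (intro limit_set_in_circle[OF G, of n p q]) (auto simp: G_def L_def)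
  then have \<Lambda>GL: "limit_set G \<subseteq> L" using limit_set_mono[OF G\<Gamma>] by (auto simp: L_def \<Lambda>_def)

  (* The hypothesis on the hull supplies a second limit point, which matters when L is a pair of points. *)
  have horo: "horospherical G \<xi>" if ne: "hull3 (limit_set G) \<noteq> {}" and \<xi>: "\<xi> \<in> limit_set G" for \<xi>
  proof (cases "\<exists>r\<in>L. r \<noteq> p \<and> r \<noteq> q")
    case True
    then obtain r where r: "r \<in> L" "q \<noteq> r" "p \<noteq> r" by blast
    have "\<xi> islimpt L" by (rule limit_set_islimpt[OF G LS inv pq(1,2) r(1) pq(3) r(2,3) \<xi>])
    then show ?thesis using \<Lambda>GL \<xi> by (intro islimpt_horospherical[OF G LS tc]) auto
  next
    case False
    then have L2: "L = {p, q}" using pq by auto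
    obtain b where b: "b \<in> limit_set G" "b \<noteq> \<xi>"
      using hull3_two_points[OF limit_set_S2 ne] by metis
    have "L = {\<xi>, b}" using L2 b \<xi> \<Lambda>GL by auto
    then show ?thesis
      using b \<xi> inv LS by (intro two_point_horospherical[OF G, of \<xi> b]) auto
  qed
  have hullG: "hull3 (limit_set G) \<subseteq> plane n"
  proof -
    have "convex {y. mink n y = 0}" by (rule convexI) (simp add: mink_linear(2,4))
    then have "convex hull (limit_set G) \<subseteq> {y. mink n y = 0}"
      using \<Lambda>GL by (intro hull_minimal) (auto simp: L_def circle_def)
    then show ?thesis by (auto simp: hull3_def plane_def)
  qed
  have "compactin (orbit_space G (plane n)) (orb G ` (plane n \<inter> hull3 (limit_set G)))"
  proof (cases "hull3 (limit_set G) = {}")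
    case False then show ?thesis by (intro hull_cocompact G horo hullG)
  qed simp
  then have "convex_cocompact_on (plane n) G"
    using par G\<Gamma> by (auto simp: convex_cocompact_on_def)
  moreover have "fuchsian n G"
    using G n1 discrete_subset[OF disc G\<Gamma>] subgroup.subset[OF \<Gamma>]
    by (auto simp: fuchsian_def kleinian_def G_def circle_stab_def)
  ultimately have 1: "convex_cocompact_fuchsian n G" by (simp add: convex_cocompact_fuchsian_def)

  obtain \<Lambda>\<^sub>0 where \<Lambda>0: "\<Lambda>\<^sub>0 \<subseteq> L" "finite \<Lambda>\<^sub>0"
    "\<And>\<xi>. \<xi> \<in> L \<Longrightarrow> \<xi> \<in> limit_set G \<or> (\<exists>g\<in>G. act g \<xi> \<in> \<Lambda>\<^sub>0)"
  proof (cases "\<exists>r\<in>L. r \<noteq> p \<and> r \<noteq> q")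
    case True
    then obtain r where r: "r \<in> L" "q \<noteq> r" "p \<noteq> r" by blast
    have "\<xi> \<in> limit_set G" if "\<xi> \<in> L" "\<xi> islimpt L" for \<xi>
      using that LS by (intro horospherical_limit[OF G] islimpt_horospherical[OF G LS tc]) auto
    then show thesis
      using isolated_points_finite[OF G LS inv pq(1,2) r(1) pq(3) r(2,3) tc] that by blast
  next
    case False
    then have "L = {p, q}" using pq by auto
    then have "finite L" by simp
    moreover have "act (mat 1) \<xi> \<in> L" if "\<xi> \<in> L" for \<xi> using that by (simp add: act_one Lcb)
    ultimately show thesis using that[of L] subgroup_one[OF G] by blast
  qed
  have "L = limit_set G \<union> (\<Union>g\<in>G. act g ` \<Lambda>\<^sub>0)"
  proof (intro equalityI subsetI)
    fix \<xi> assume \<xi>: "\<xi> \<in> L"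
    show "\<xi> \<in> limit_set G \<union> (\<Union>g\<in>G. act g ` \<Lambda>\<^sub>0)"
    proof (cases "\<xi> \<in> limit_set G")
      case False
      then obtain g where g: "g \<in> G" "act g \<xi> \<in> \<Lambda>\<^sub>0" using \<Lambda>0(3)[OF \<xi>] by blast
      obtain h where h: "h \<in> G" "h ** g = mat 1" using subgroup_inverse[OF G g(1)] by blast
      have "\<xi> = act h (act g \<xi>)" using act_inverse[OF lor[OF g(1)] lor[OF h(1)] h(2) Lcb[OF \<xi>]] by simp
      then show ?thesis using h(1) g(2) by blast
    qed simp
  qed (use \<Lambda>GL \<Lambda>0(1) inv in auto)
  moreover have "\<Lambda>\<^sub>0 \<subseteq> S2" using \<Lambda>0(1) LS by blast
  ultimately show ?thesis
    using 1 \<Lambda>0(2) unfolding L_def G_def \<Lambda>_def by blast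
qed

end
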